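(* The class of star forests, the class of complete bipartite graphs and the class of complete graphs are the only three minimal hereditary classes of graphs of unbounded $h$-index. That is, each of these three hereditary classes has unbounded $h$-index and contains no proper hereditary subclass of unbounded $h$-index, and every hereditary class of graphs of unbounded $h$-index contains at least one of the three.
   Context: All graphs are finite and simple; classes are closed under isomorphism. A class of graphs is hereditary if it is closed under taking induced subgraphs. The $h$-index $h(G)$ of a graph $G$ is the largest $k\ge 0$ such that $G$ has $k$ vertices of degree at least $k$; a class has unbounded $h$-index if there is no constant bounding $h(G)$ over all $G$ in the class. A star is a graph $K_{1,n}$ with $n\ge 0$ (so $K_{1,0}$ is a single vertex), and a star forest is a disjoint union of stars. In the class of complete bipartite graphs one of the two parts is allowed to be empty (so edgeless graphs are included), making the class hereditary. *)

theory Defs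
  imports "Graph_Theory.Graph_Theory" "HOL-Library.Disjoint_Sets"
begin

text \<open>
  A finite simple graph is a \<^locale>\<open>pair_graph\<close>: a finite set of vertices together with an
  irreflexive symmetric arc relation, each edge being a pair of opposite arcs. The null graph is
  allowed. Every finite graph is isomorphic to one with vertices in \<^typ>\<open>nat\<close>, so
  isomorphism-closed classes of finite graphs correspond to isomorphism-closed sets of graphs
  over \<^typ>\<open>nat\<close>.
\<close>

type_synonym ngraph = "nat pair_pre_digraph"

definition graph_class :: "ngraph set \<Rightarrow> bool" where
  "graph_class C \<longleftrightarrow>
     (\<forall>G\<in>C. pair_graph G) \<and>
     (\<forall>G\<in>C. \<forall>H. digraph_iso (with_proj G) (with_proj H) \<longrightarrow> H \<in> C)"

definition hereditary :: "ngraph set \<Rightarrow> bool" where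
  "hereditary C \<longleftrightarrow> graph_class C \<and>
     (\<forall>G\<in>C. \<forall>H. induced_subgraph (with_proj H) (with_proj G) \<longrightarrow> H \<in> C)"

text \<open>
  In a symmetric digraph without parallel arcs the out-degree of a vertex is its degree in the
  undirected graph.
\<close>

definition h_index :: "ngraph \<Rightarrow> nat" where
  "h_index G = (GREATEST k. k \<le> card {v \<in> pverts G. k \<le> out_degree (with_proj G) v})"

definition unbounded_h_index :: "ngraph set \<Rightarrow> bool" where
  "unbounded_h_index C \<longleftrightarrow> \<not> (\<exists>b. \<forall>G\<in>C. h_index G \<le> b)"

definition minimal_hereditary_unbounded :: "ngraph set \<Rightarrow> bool" where
  "minimal_hereditary_unbounded C \<longleftrightarrow>
     hereditary C \<and> unbounded_h_index C \<and>
     \<not> (\<exists>D. D \<subset> C \<and> hereditary D \<and> unbounded_h_index D)"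

definition star :: "ngraph \<Rightarrow> bool" where
  "star G \<longleftrightarrow> (\<exists>n. complete_bipartite_digraph 1 n (with_proj G))"

definition star_forests :: "ngraph set" where
  "star_forests = {G. \<exists>S. finite S \<and> (\<forall>H\<in>S. star H) \<and> disjoint_family_on pverts S \<and>
     pverts G = (\<Union>H\<in>S. pverts H) \<and> parcs G = (\<Union>H\<in>S. parcs H)}"

text \<open>Either part may be empty below, so all edgeless graphs are included.\<close>

definition complete_bipartite_graphs :: "ngraph set" where
  "complete_bipartite_graphs = {G. \<exists>m n. complete_bipartite_digraph m n (with_proj G)}"

definition complete_graphs :: "ngraph set" where
  "complete_graphs = {G. \<exists>n. complete_digraph n (with_proj G)}"

end

theory Submission
  imports Defs "HOL-Library.Ramsey"
begin

text \<open>
  A graph of large h-index has many vertices of large degree. Unless there is a large clique,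
  Ramsey's theorem gives a large independent set \<open>A\<close> of such vertices and inside each neighbourhood
  a much larger independent set. By pigeonhole each of these may be thinned to a set \<open>B a\<close> all of
  whose vertices have the same neighbours \<open>T a\<close> in \<open>A\<close>. If some \<open>T a\<close> is large, then \<open>B a\<close> and \<open>T a\<close>
  induce a large complete bipartite graph. Otherwise the digraph \<open>a \<rightarrow> b\<close> for \<open>b \<in> T a\<close> has small
  out-degrees, so there are many \<open>a\<close> each of which is adjacent to no set \<open>B b\<close> but its own. A bipartite
  Ramsey argument applied to each pair of these sets then either finds a large induced complete
  bipartite graph or removes all edges between them, leaving many induced disjoint large stars. Every
  complete graph, complete bipartite graph or star forest embeds in a large enough structure of its
  kind, so a hereditary class of unbounded h-index contains one of the three classes; minimality
  follows because the three are pairwise incomparable.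
\<close>

subsection \<open>Unavoidable induced structures\<close>

text \<open>The order picks one direction for each unordered pair, so \<open>R\<close> on increasing
  pairs becomes an undirected edge set \<open>E\<close> and the two-colour Ramsey theorem applies.
  In this form \<open>R\<close> may be the arc relation of a digraph, or its converse.\<close>

lemma ramsey_linorder:
  "\<exists>N. \<forall>(A :: 'a :: linorder set) R. finite A \<longrightarrow> N \<le> card A \<longrightarrow>
     (\<exists>H\<subseteq>A. card H = m \<and> (\<forall>a\<in>H. \<forall>b\<in>H. a < b \<longrightarrow> R a b) \<or>
             card H = n \<and> (\<forall>a\<in>H. \<forall>b\<in>H. a < b \<longrightarrow> \<not> R a b))"
proof -
  obtain N where N: "\<And>(V :: 'a set) E. finite V \<Longrightarrow> N \<le> card V \<Longrightarrow>
      \<exists>H\<subseteq>V. card H = m \<and> clique H E \<or> card H = n \<and> indep H E"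
    using ramsey2[of m n] by blast
  show ?thesis
  proof (rule exI[of _ N], intro allI impI)
    fix A :: "'a set" and R :: "'a \<Rightarrow> 'a \<Rightarrow> bool"
    assume "finite A" "N \<le> card A"
    define E where "E = {{a, b} | a b. a < b \<and> R a b}"
    have E: "{a, b} \<in> E \<longleftrightarrow> R a b" if "a < b" for a b
      using that by (auto simp: E_def doubleton_eq_iff dest: less_asym)
    obtain H where "H \<subseteq> A" "card H = m \<and> clique H E \<or> card H = n \<and> indep H E"
      using N[OF \<open>finite A\<close> \<open>N \<le> card A\<close>] by blast
    then show "\<exists>H\<subseteq>A. card H = m \<and> (\<forall>a\<in>H. \<forall>b\<in>H. a < b \<longrightarrow> R a b) \<or>
        card H = n \<and> (\<forall>a\<in>H. \<forall>b\<in>H. a < b \<longrightarrow> \<not> R a b)"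
      by (intro exI[of _ H]) (auto simp: clique_def indep_def simp flip: E)
  qed
qed

section \<open>Homogeneous pairs and families by pigeonhole\<close>

lemma pigeonhole_fiber:
  assumes "finite A" "f ` A \<subseteq> B" "finite B" "card B * m \<le> card A" "B \<noteq> {}"
  obtains y where "y \<in> B" "m \<le> card {x\<in>A. f x = y}"
proof -
  have "\<exists>y\<in>B. card A \<le> card (f -` {y} \<inter> A) * card B"
    using assms by (intro pigeonhole_card) auto
  then obtain y where y: "y \<in> B" "card A \<le> card (f -` {y} \<inter> A) * card B"
    by blast
  have "card B * m \<le> card B * card (f -` {y} \<inter> A)"
    using le_trans[OF assms(4) y(2)] by (simp add: mult.commute)
  moreover have "0 < card B"
    using assms by (simp add: card_gt_0_iff)
  moreover have "f -` {y} \<inter> A = {x\<in>A. f x = y}"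
    by auto
  ultimately show thesis
    using y(1) that by simp
qed

text \<open>Keep only \<open>k + m\<close> vertices of \<open>Y\<close>. The vertices of
  \<open>X\<close> then have at most \<open>2 ^ (k + m)\<close> different traces on them, and some
  trace \<open>T\<close> is shared by \<open>k + m\<close> vertices of \<open>X\<close>. Either
  \<open>T\<close> has \<open>k\<close> elements or its complement in the kept part of
  \<open>Y\<close> has \<open>m\<close>.\<close>

lemma homogeneous_pair:
  fixes r :: "'a rel"
  assumes "finite X" "finite Y" "2 ^ (k + m) * (k + m) \<le> card X" "k + m \<le> card Y"
  obtains (complete) X' Y' where "X' \<subseteq> X" "Y' \<subseteq> Y" "card X' = k" "card Y' = k" "X' \<times> Y' \<subseteq> r"
  | (empty) X' Y' where "X' \<subseteq> X" "Y' \<subseteq> Y" "card X' = m" "card Y' = m" "X' \<times> Y' \<inter> r = {}"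
proof -
  obtain Y0 where Y0: "Y0 \<subseteq> Y" "card Y0 = k + m" "finite Y0"
    using obtain_subset_with_card_n[OF assms(4)] by metis
  obtain T where T: "T \<in> Pow Y0" "k + m \<le> card {x\<in>X. r `` {x} \<inter> Y0 = T}"
    using pigeonhole_fiber[of X "\<lambda>x. r `` {x} \<inter> Y0" "Pow Y0" "k + m"] assms Y0
    by (auto simp: card_Pow)
  define X0 where "X0 = {x\<in>X. r `` {x} \<inter> Y0 = T}"
  have X0: "k \<le> card X0" "m \<le> card X0" "X0 \<subseteq> X"
    using T by (auto simp: X0_def)
  show thesis
  proof (cases "k \<le> card T")
    case True
    obtain X' Y' where "X' \<subseteq> X0" "card X' = k" "Y' \<subseteq> T" "card Y' = k"
      using obtain_subset_with_card_n X0(1) True by metis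
    then show thesis
      using X0 T Y0 by (intro complete[of X' Y']) (auto simp: X0_def)
  next
    case False
    then have "m \<le> card (Y0 - T)"
      using T Y0 by (simp add: card_Diff_subset finite_subset)
    then obtain X' Y' where "X' \<subseteq> X0" "card X' = m" "Y' \<subseteq> Y0 - T" "card Y' = m"
      using obtain_subset_with_card_n X0(2) by metis
    then show thesis
      using X0 T Y0 by (intro empty[of X' Y']) (auto simp: X0_def)
  qed
qed

text \<open>Induction on the number of pairs: one pair is set aside, the others are treated with a
  larger target size, and \<open>homogeneous_pair\<close> then settles the pair set aside. The bound
  \<open>L\<close> is chosen before the relation and the sets, so it depends only on
  \<open>k\<close>, \<open>p\<close> and \<open>m\<close>.\<close>

lemma homogeneous_family:
  fixes k p m :: nat
  shows "\<exists>L. \<forall>(r :: 'a rel) (P :: 'i rel) I B. finite P \<longrightarrow> card P = p \<longrightarrow> P \<subseteq> I \<times> I \<longrightarrow>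
     (\<forall>(i, j)\<in>P. i \<noteq> j) \<longrightarrow> (\<forall>i\<in>I. finite (B i) \<and> L \<le> card (B i)) \<longrightarrow>
     (\<exists>(i, j)\<in>P. \<exists>X\<subseteq>B i. \<exists>Y\<subseteq>B j. card X = k \<and> card Y = k \<and> X \<times> Y \<subseteq> r) \<or>
     (\<exists>B'. (\<forall>i\<in>I. B' i \<subseteq> B i \<and> m \<le> card (B' i)) \<and> (\<forall>(i, j)\<in>P. B' i \<times> B' j \<inter> r = {}))"
    (is "\<exists>L. \<forall>r P I B. ?Q L p m r P I B")
proof (induction p arbitrary: m)
  case 0
  have "?Q m 0 m r P I B" for r P I B
    by auto
  then show ?case by (intro exI allI)
next
  case (Suc p)
  \<comment> \<open>The target size for the first \<open>p\<close> pairs: large enough for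
    \<open>homogeneous_pair\<close> on the last one. It is also at least \<open>k + m\<close>, which
    serves the second set of that pair and the sets outside it.\<close>
  define L0 where "L0 = 2 ^ (k + m) * (k + m)"
  have "1 * (k + m) \<le> L0"
    unfolding L0_def by (rule mult_right_mono) auto
  then have L0: "k + m \<le> L0" by simp
  obtain L where "\<forall>r P I B. ?Q L p L0 r P I B"
    using Suc.IH[of L0] by (rule exE)
  then have L: "?Q L p L0 r P I B" for r P I B by (elim allE)
  have "?Q L (Suc p) m r P I B" for r :: "'a rel" and P :: "'i rel" and I B
  proof (intro impI)
    assume P: "finite P" "card P = Suc p" "P \<subseteq> I \<times> I" "\<forall>(i, j)\<in>P. i \<noteq> j"
      and B: "\<forall>i\<in>I. finite (B i) \<and> L \<le> card (B i)"
    obtain a b Q where Q: "P = insert (a, b) Q" "(a, b) \<notin> Q" "card Q = p" "finite Q"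
      using P by (metis card_Suc_eq finite_insert old.prod.exhaust)
    then have ab: "a \<noteq> b" "a \<in> I" "b \<in> I" using P by auto
    show "(\<exists>(i, j)\<in>P. \<exists>X\<subseteq>B i. \<exists>Y\<subseteq>B j. card X = k \<and> card Y = k \<and> X \<times> Y \<subseteq> r) \<or>
      (\<exists>B'. (\<forall>i\<in>I. B' i \<subseteq> B i \<and> m \<le> card (B' i)) \<and> (\<forall>(i, j)\<in>P. B' i \<times> B' j \<inter> r = {}))"
      (is "?complete P \<or> ?empty")
    proof (cases "?complete P")
      case False
      then have "\<not> ?complete Q" using Q by blast
      moreover have "Q \<subseteq> I \<times> I" "\<forall>(i, j)\<in>Q. i \<noteq> j"
        using P Q by auto
      then have "?complete Q \<or> (\<exists>B'. (\<forall>i\<in>I. B' i \<subseteq> B i \<and> L0 \<le> card (B' i)) \<and>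
          (\<forall>(i, j)\<in>Q. B' i \<times> B' j \<inter> r = {}))"
        by (intro L[THEN mp, THEN mp, THEN mp, THEN mp, THEN mp] Q B)
      ultimately have "\<exists>B'. (\<forall>i\<in>I. B' i \<subseteq> B i \<and> L0 \<le> card (B' i)) \<and>
          (\<forall>(i, j)\<in>Q. B' i \<times> B' j \<inter> r = {})"
        by argo
      then obtain B0 where B0: "\<forall>i\<in>I. B0 i \<subseteq> B i \<and> L0 \<le> card (B0 i)"
        "\<forall>(i, j)\<in>Q. B0 i \<times> B0 j \<inter> r = {}"
        by (elim exE conjE)
      have fin: "finite (B0 a)" "finite (B0 b)"
        using ab B B0(1) by (meson finite_subset)+
      have "2 ^ (k + m) * (k + m) \<le> card (B0 a)" "k + m \<le> card (B0 b)"
        using ab B0(1) order.trans[OF L0] by (auto simp flip: L0_def)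
      with fin show ?thesis
      proof (cases rule: homogeneous_pair[where r = r])
        case (complete X' Y')
        then have "X' \<subseteq> B a" "Y' \<subseteq> B b"
          using B0(1) ab by blast+
        then have "\<exists>X\<subseteq>B a. \<exists>Y\<subseteq>B b. card X = k \<and> card Y = k \<and> X \<times> Y \<subseteq> r"
          using complete by blast
        then show ?thesis
          unfolding Q by simp
      next
        case (empty X' Y')
        have m: "m \<le> card (B0 i)" if "i \<in> I" for i
          using that B0(1) L0 by (meson add_leD2 le_trans)
        \<comment> \<open>Only the two sets of the last pair shrink, and \<open>a\<close> and
          \<open>b\<close> are distinct, so the updates do not clash. Emptiness for the earlier
          pairs passes to subsets.\<close>
        define B' where "B' = B0(a := X', b := Y')"
        have sub: "B' i \<subseteq> B0 i" for i
          using empty by (auto simp: B'_def)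
        have "\<forall>(i, j)\<in>P. B' i \<times> B' j \<inter> r = {}"
        proof safe
          fix i j x y assume ij: "(i, j) \<in> P" "x \<in> B' i" "y \<in> B' j" "(x, y) \<in> r"
          show "(x, y) \<in> {}"
          proof (cases "(i, j) = (a, b)")
            case True
            then show ?thesis using ij empty ab by (auto simp: B'_def)
          next
            case False
            then have "(i, j) \<in> Q" using ij Q by auto
            then show ?thesis using B0(2) sub ij by fast
          qed
        qed
        moreover have "\<forall>i\<in>I. B' i \<subseteq> B i \<and> m \<le> card (B' i)"
        proof (intro ballI conjI)
          fix i assume i: "i \<in> I"
          show "B' i \<subseteq> B i" using i sub[of i] B0(1) by blast
          show "m \<le> card (B' i)" using m[OF i] empty by (simp add: B'_def)
        qed
        ultimately show ?thesis by blast
      qed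
    qed blast
  qed
  then show ?case by (intro exI allI)
qed

section \<open>Induced configurations and Ramsey arguments for them\<close>

definition clique_in :: "nat \<Rightarrow> 'a set \<Rightarrow> 'a rel \<Rightarrow> bool" where
  "clique_in k V r \<longleftrightarrow> (\<exists>H\<subseteq>V. card H = k \<and> (\<forall>a\<in>H. \<forall>b\<in>H. a \<noteq> b \<longrightarrow> (a, b) \<in> r))"

text \<open>The sides are automatically disjoint: a common vertex would have a loop by the last
  clause and none by the first two.\<close>

definition biclique_in :: "nat \<Rightarrow> 'a set \<Rightarrow> 'a rel \<Rightarrow> bool" where
  "biclique_in k V r \<longleftrightarrow> (\<exists>X\<subseteq>V. \<exists>Y\<subseteq>V. card X = k \<and> card Y = k \<and>
     X \<times> X \<inter> r = {} \<and> Y \<times> Y \<inter> r = {} \<and> X \<times> Y \<subseteq> r)"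

text \<open>These are \<open>k\<close> disjoint induced stars with centres \<open>a\<close> and leaf
  sets \<open>B a\<close>. The case \<open>a = b\<close> makes each leaf set independent. Leaf sets
  of different centres are disjoint because a leaf is adjacent to exactly one centre, and no leaf is
  a centre because the centres are independent.\<close>

definition stars_in :: "nat \<Rightarrow> 'a set \<Rightarrow> 'a rel \<Rightarrow> bool" where
  "stars_in k V r \<longleftrightarrow> (\<exists>A\<subseteq>V. \<exists>B. card A = k \<and> A \<times> A \<inter> r = {} \<and>
     (\<forall>a\<in>A. B a \<subseteq> V \<and> k \<le> card (B a)) \<and>
     (\<forall>a\<in>A. \<forall>b\<in>A. B a \<times> B b \<inter> r = {} \<and> (\<forall>x\<in>B b. (a, x) \<in> r \<longleftrightarrow> a = b)))"

lemma clique_or_independent: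
  "\<exists>N. \<forall>(A :: 'a :: linorder set) r. finite A \<longrightarrow> N \<le> card A \<longrightarrow> sym r \<longrightarrow> irrefl r \<longrightarrow>
     clique_in k A r \<or> (\<exists>H\<subseteq>A. card H = n \<and> H \<times> H \<inter> r = {})"
proof -
  obtain N where N: "\<forall>(A :: 'a set) R. finite A \<longrightarrow> N \<le> card A \<longrightarrow>
     (\<exists>H\<subseteq>A. card H = k \<and> (\<forall>a\<in>H. \<forall>b\<in>H. a < b \<longrightarrow> R a b) \<or>
             card H = n \<and> (\<forall>a\<in>H. \<forall>b\<in>H. a < b \<longrightarrow> \<not> R a b))"
    using ramsey_linorder[of k n] by (rule exE)
  show ?thesis
  proof (rule exI[of _ N], intro allI impI)
    fix A :: "'a set" and r :: "'a rel"
    assume A: "finite A" "N \<le> card A" and r: "sym r" "irrefl r"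
    have "\<exists>H\<subseteq>A. card H = k \<and> (\<forall>a\<in>H. \<forall>b\<in>H. a < b \<longrightarrow> (a, b) \<in> r) \<or>
             card H = n \<and> (\<forall>a\<in>H. \<forall>b\<in>H. a < b \<longrightarrow> (a, b) \<notin> r)"
      using N[THEN spec, THEN spec, of A "\<lambda>a b. (a, b) \<in> r"] A by simp
    then obtain H where "H \<subseteq> A" and H: "card H = k \<and> (\<forall>a\<in>H. \<forall>b\<in>H. a < b \<longrightarrow> (a, b) \<in> r) \<or>
             card H = n \<and> (\<forall>a\<in>H. \<forall>b\<in>H. a < b \<longrightarrow> (a, b) \<notin> r)"
      by blast
    from H show "clique_in k A r \<or> (\<exists>H\<subseteq>A. card H = n \<and> H \<times> H \<inter> r = {})"
    proof (elim disjE conjE)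
      assume *: "card H = k" "\<forall>a\<in>H. \<forall>b\<in>H. a < b \<longrightarrow> (a, b) \<in> r"
      have "\<forall>a\<in>H. \<forall>b\<in>H. a \<noteq> b \<longrightarrow> (a, b) \<in> r"
        using * r(1) by (metis linorder_neqE symD)
      then show ?thesis using * \<open>H \<subseteq> A\<close> unfolding clique_in_def by blast
    next
      assume *: "card H = n" "\<forall>a\<in>H. \<forall>b\<in>H. a < b \<longrightarrow> (a, b) \<notin> r"
      have "\<forall>a\<in>H. \<forall>b\<in>H. (a, b) \<notin> r"
        using * r by (metis linorder_neqE symD irreflD)
      then show ?thesis using * \<open>H \<subseteq> A\<close> by blast
    qed
  qed
qed

text \<open>
  Ramsey is applied to the forward arcs and then to the backward arcs: in a set of \<open>k + 1\<close> vertices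
  with all forward (backward) arcs present, the least (greatest) vertex would have out-degree \<open>k\<close>.
\<close>

lemma sparse_digraph_independent:
  "\<exists>N. \<forall>(A :: 'a :: linorder set) T. finite A \<longrightarrow> N \<le> card A \<longrightarrow> (\<forall>a\<in>A. finite (T a) \<and> card (T a) < k) \<longrightarrow>
     (\<exists>H\<subseteq>A. card H = n \<and> (\<forall>a\<in>H. \<forall>b\<in>H. a \<noteq> b \<longrightarrow> b \<notin> T a))"
proof -
  obtain N1 where N1: "\<forall>(A :: 'a set) R. finite A \<longrightarrow> N1 \<le> card A \<longrightarrow>
     (\<exists>H\<subseteq>A. card H = Suc k \<and> (\<forall>a\<in>H. \<forall>b\<in>H. a < b \<longrightarrow> R a b) \<or>
             card H = n \<and> (\<forall>a\<in>H. \<forall>b\<in>H. a < b \<longrightarrow> \<not> R a b))"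
    using ramsey_linorder[of "Suc k" n] by (rule exE)
  \<comment> \<open>Ramsey with \<open>N2\<close> is used first and must leave \<open>N1\<close>
    vertices for the second application.\<close>
  obtain N2 where N2: "\<forall>(A :: 'a set) R. finite A \<longrightarrow> N2 \<le> card A \<longrightarrow>
     (\<exists>H\<subseteq>A. card H = Suc k \<and> (\<forall>a\<in>H. \<forall>b\<in>H. a < b \<longrightarrow> R a b) \<or>
             card H = N1 \<and> (\<forall>a\<in>H. \<forall>b\<in>H. a < b \<longrightarrow> \<not> R a b))"
    using ramsey_linorder[of "Suc k" N1] by (rule exE)
  show ?thesis
  proof (rule exI[of _ N2], intro allI impI)
    fix A :: "'a set" and T :: "'a \<Rightarrow> 'a set"
    assume A: "finite A" "N2 \<le> card A" and T: "\<forall>a\<in>A. finite (T a) \<and> card (T a) < k"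
    have few: False if "H \<subseteq> A" "a \<in> H" "card H = Suc k" "H - {a} \<subseteq> T a" for H a
    proof -
      have "k \<le> card (T a)"
        using that T card_mono[of "T a" "H - {a}"] by auto
      then show False using T that by (meson not_le subsetD)
    qed
    have ends: "Min H \<in> H" "Max H \<in> H" "\<forall>b\<in>H - {Min H}. Min H < b" "\<forall>b\<in>H - {Max H}. b < Max H"
      if "H \<subseteq> A" "card H = Suc k" for H
    proof -
      have "finite H" "H \<noteq> {}" using that A finite_subset by auto
      then show "Min H \<in> H" "Max H \<in> H" "\<forall>b\<in>H - {Min H}. Min H < b" "\<forall>b\<in>H - {Max H}. b < Max H"
        by (auto simp: less_le)
    qed
    obtain A1 where A1: "A1 \<subseteq> A" "card A1 = Suc k \<and> (\<forall>a\<in>A1. \<forall>b\<in>A1. a < b \<longrightarrow> b \<in> T a) \<or>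
             card A1 = N1 \<and> (\<forall>a\<in>A1. \<forall>b\<in>A1. a < b \<longrightarrow> b \<notin> T a)"
      using N2[THEN spec, THEN spec, of A "\<lambda>a b. b \<in> T a"] A by auto
    have 1: "card A1 = N1" "\<forall>a\<in>A1. \<forall>b\<in>A1. a < b \<longrightarrow> b \<notin> T a"
      using A1 few[of A1 "Min A1"] ends[of A1] by blast+
    obtain A2 where A2: "A2 \<subseteq> A1" "card A2 = Suc k \<and> (\<forall>a\<in>A2. \<forall>b\<in>A2. a < b \<longrightarrow> a \<in> T b) \<or>
             card A2 = n \<and> (\<forall>a\<in>A2. \<forall>b\<in>A2. a < b \<longrightarrow> a \<notin> T b)"
      using N1[THEN spec, THEN spec, of A1 "\<lambda>a b. a \<in> T b"] A finite_subset[OF A1(1)] 1 by auto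
    have 2: "card A2 = n" "\<forall>a\<in>A2. \<forall>b\<in>A2. a < b \<longrightarrow> a \<notin> T b"
      using A1(1) A2 few[of A2 "Max A2"] ends[of A2] by blast+
    have "\<forall>a\<in>A2. \<forall>b\<in>A2. a \<noteq> b \<longrightarrow> b \<notin> T a"
      using 1 2 A2(1) by (metis linorder_neqE subsetD)
    then show "\<exists>H\<subseteq>A. card H = n \<and> (\<forall>a\<in>H. \<forall>b\<in>H. a \<noteq> b \<longrightarrow> b \<notin> T a)"
      using 2(1) order.trans[OF A2(1) A1(1)] by (intro exI[of _ A2] conjI)
  qed
qed

text \<open>Here \<open>S\<close> is the set of vertices of large degree witnessing a large h-index.
  The constants are fixed in the reverse of the order in which the argument consumes them: the final
  thinning of leaf sets first, the Ramsey numbers for \<open>S\<close> and for the neighbourhoods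
  last.\<close>

lemma unavoidable_structures:
  "\<exists>N. \<forall>V (r :: 'a :: linorder rel) S. finite V \<longrightarrow> r \<subseteq> V \<times> V \<longrightarrow> sym r \<longrightarrow> irrefl r \<longrightarrow>
     S \<subseteq> V \<longrightarrow> N \<le> card S \<longrightarrow> (\<forall>v\<in>S. N \<le> card (r `` {v})) \<longrightarrow>
     clique_in k V r \<or> biclique_in k V r \<or> stars_in k V r"
proof -
  \<comment> \<open>\<open>k * k - k\<close> is the number of ordered pairs of distinct elements of
    the final set of \<open>k\<close> centres.\<close>
  obtain L0 where L0: "\<forall>(r :: 'a rel) (P :: 'a rel) I B. finite P \<longrightarrow> card P = k * k - k \<longrightarrow> P \<subseteq> I \<times> I \<longrightarrow>
     (\<forall>(i, j)\<in>P. i \<noteq> j) \<longrightarrow> (\<forall>i\<in>I. finite (B i) \<and> L0 \<le> card (B i)) \<longrightarrow>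
     (\<exists>(i, j)\<in>P. \<exists>X\<subseteq>B i. \<exists>Y\<subseteq>B j. card X = k \<and> card Y = k \<and> X \<times> Y \<subseteq> r) \<or>
     (\<exists>B'. (\<forall>i\<in>I. B' i \<subseteq> B i \<and> k \<le> card (B' i)) \<and> (\<forall>(i, j)\<in>P. B' i \<times> B' j \<inter> r = {}))"
    using homogeneous_family[where p = "k * k - k" and k = k and m = k] by (rule exE)
  \<comment> \<open>Leaf sets of size \<open>L\<close> must admit the family argument and also
    supply one side of a biclique with \<open>k\<close> vertices.\<close>
  define L where "L = max k L0"
  obtain M where M: "\<forall>(A :: 'a set) T. finite A \<longrightarrow> M \<le> card A \<longrightarrow>
     (\<forall>a\<in>A. finite (T a) \<and> card (T a) < k) \<longrightarrow>
     (\<exists>H\<subseteq>A. card H = k \<and> (\<forall>a\<in>H. \<forall>b\<in>H. a \<noteq> b \<longrightarrow> b \<notin> T a))"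
    using sparse_digraph_independent[of k k] by (rule exE)
  obtain N1 where N1: "\<forall>(A :: 'a set) r. finite A \<longrightarrow> N1 \<le> card A \<longrightarrow> sym r \<longrightarrow> irrefl r \<longrightarrow>
     clique_in k A r \<or> (\<exists>H\<subseteq>A. card H = M \<and> H \<times> H \<inter> r = {})"
    using clique_or_independent[of k M] by (rule exE)
  \<comment> \<open>The factor \<open>2 ^ M\<close> pays for the pigeonhole over all traces on a set
    of \<open>M\<close> candidate centres, leaving \<open>L\<close> vertices with the same
    trace.\<close>
  obtain N2 where N2: "\<forall>(A :: 'a set) r. finite A \<longrightarrow> N2 \<le> card A \<longrightarrow> sym r \<longrightarrow> irrefl r \<longrightarrow>
     clique_in k A r \<or> (\<exists>H\<subseteq>A. card H = 2 ^ M * L \<and> H \<times> H \<inter> r = {})"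
    using clique_or_independent[of k "2 ^ M * L"] by (rule exE)
  show ?thesis
  proof (rule exI[of _ "max N1 N2"], intro allI impI, rule ccontr)
    fix V S :: "'a set" and r :: "'a rel"
    assume V: "finite V" "r \<subseteq> V \<times> V" and r: "sym r" "irrefl r"
      and S: "S \<subseteq> V" "max N1 N2 \<le> card S" "\<forall>v\<in>S. max N1 N2 \<le> card (r `` {v})"
      and neg: "\<not> (clique_in k V r \<or> biclique_in k V r \<or> stars_in k V r)"
    have no_clique: "\<not> clique_in k A r" if "A \<subseteq> V" for A
      using neg that unfolding clique_in_def by blast
    have no_biclique: False
      if "X' \<subseteq> V" "Y' \<subseteq> V" "X' \<times> X' \<inter> r = {}" "Y' \<times> Y' \<inter> r = {}"
        "X \<subseteq> X'" "Y \<subseteq> Y'" "card X = k" "card Y = k" "X \<times> Y \<subseteq> r" for X Y X' Y'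
    proof -
      have "X \<subseteq> V" "Y \<subseteq> V" "X \<times> X \<inter> r = {}" "Y \<times> Y \<inter> r = {}"
        using that by blast+
      then have "biclique_in k V r"
        unfolding biclique_in_def using that by blast
      then show False using neg by simp
    qed
    have fin: "finite A" if "A \<subseteq> V" for A
      using V(1) that finite_subset by blast
    have nb: "r `` {v} \<subseteq> V" for v using V by auto
    obtain A0 where A0: "A0 \<subseteq> S" "card A0 = M" "A0 \<times> A0 \<inter> r = {}"
      using N1[THEN spec, THEN spec, of S r] no_clique fin S r by auto
    have A0V: "A0 \<subseteq> V" using A0 S by auto
    have "\<exists>B0. B0 \<subseteq> r `` {a} \<and> card B0 = 2 ^ M * L \<and> B0 \<times> B0 \<inter> r = {}" if "a \<in> A0" for a
      using N2[THEN spec, THEN spec, of "r `` {a}" r] that no_clique fin nb A0(1) S r by auto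
    then obtain B0 where B0: "\<And>a. a \<in> A0 \<Longrightarrow> B0 a \<subseteq> r `` {a}"
      "\<And>a. a \<in> A0 \<Longrightarrow> card (B0 a) = 2 ^ M * L" "\<And>a. a \<in> A0 \<Longrightarrow> B0 a \<times> B0 a \<inter> r = {}"
      by metis
    have B0_fin: "finite (B0 a)" if "a \<in> A0" for a
      using B0(1)[OF that] nb fin by blast
    \<comment> \<open>Pigeonhole on the neighbourhoods within \<open>A0\<close> of the vertices of
      \<open>B0 a\<close>.\<close>
    have "\<exists>T. T \<subseteq> A0 \<and> L \<le> card {x\<in>B0 a. r `` {x} \<inter> A0 = T}" if "a \<in> A0" for a
      by (rule pigeonhole_fiber[of "B0 a" "\<lambda>x. r `` {x} \<inter> A0" "Pow A0" L])
        (use that fin[OF A0V] B0_fin B0(2) A0(2) in \<open>auto simp: card_Pow\<close>)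
    then have "\<forall>a\<in>A0. \<exists>T. T \<subseteq> A0 \<and> L \<le> card {x\<in>B0 a. r `` {x} \<inter> A0 = T}" by blast
    from bchoice[OF this] obtain T where T: "\<And>a. a \<in> A0 \<Longrightarrow> T a \<subseteq> A0"
      "\<And>a. a \<in> A0 \<Longrightarrow> L \<le> card {x\<in>B0 a. r `` {x} \<inter> A0 = T a}"
      by blast
    define B1 where "B1 a = {x\<in>B0 a. r `` {x} \<inter> A0 = T a}" for a
    have B1: "B1 a \<subseteq> r `` {a}" "B1 a \<subseteq> V" "B1 a \<times> B1 a \<inter> r = {}"
      "k \<le> card (B1 a)" "L0 \<le> card (B1 a)" "B1 a \<times> T a \<subseteq> r" if "a \<in> A0" for a
      using B0[OF that] subset_trans[OF B0(1)[OF that] nb] T[OF that] by (auto simp: B1_def L_def)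
    \<comment> \<open>Otherwise \<open>k\<close> vertices of \<open>B1 a\<close> and
      \<open>k\<close> vertices of \<open>T a\<close> form an induced biclique: both sets are
      independent and completely joined.\<close>
    have "card (T a) < k" if a: "a \<in> A0" for a
    proof (rule ccontr)
      assume "\<not> card (T a) < k"
      then obtain X Y where XY: "X \<subseteq> B1 a" "card X = k" "Y \<subseteq> T a" "card Y = k"
        using obtain_subset_with_card_n B1(4)[OF a] by (metis not_less)
      have "X \<times> Y \<subseteq> r" using XY B1(6)[OF a] by blast
      then show False
        using no_biclique[OF B1(2)[OF a] A0V B1(3)[OF a] A0(3)] XY T(1)[OF a] by blast
    qed
    moreover have "finite (T a)" if "a \<in> A0" for a
      using T(1)[OF that] A0V fin by blast
    \<comment> \<open>The digraph with arcs from \<open>a\<close> to the elements of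
      \<open>T a\<close> has out-degrees below \<open>k\<close>, so it has a large set of vertices
      without arcs between distinct members.\<close>
    ultimately obtain A where A: "A \<subseteq> A0" "card A = k" "\<forall>a\<in>A. \<forall>b\<in>A. a \<noteq> b \<longrightarrow> b \<notin> T a"
      using M[THEN spec, THEN spec, of A0 T] fin[OF A0V] A0(2) by auto
    have "finite A" using A(1) A0V fin by blast
    define P where "P = A \<times> A - Id_on A"
    have "card (Id_on A) = k"
      using A(2) card_image[of "\<lambda>a. (a, a)" A] by (simp add: Id_on_def inj_on_def UNION_singleton_eq_range)
    then have "card P = k * k - k"
      using A(2) \<open>finite A\<close> by (simp add: P_def card_Diff_subset Id_on_subset_Times finite_subset[OF Id_on_subset_Times] card_cartesian_product)
    \<comment> \<open>All pairs of leaf sets are treated together: either some pair contains a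
      complete pair of sides, or the leaf sets can be thinned until no edges run between different
      ones.\<close>
    then consider i j X Y where "(i, j) \<in> P" "X \<subseteq> B1 i" "Y \<subseteq> B1 j" "card X = k" "card Y = k" "X \<times> Y \<subseteq> r"
      | B where "\<forall>i\<in>A. B i \<subseteq> B1 i \<and> k \<le> card (B i)" "\<forall>(i, j)\<in>P. B i \<times> B j \<inter> r = {}"
      using L0[THEN spec, THEN spec, THEN spec, THEN spec, of P A B1 r] \<open>finite A\<close> A(1) B1 fin
      by (auto simp: P_def subset_iff)
    then show False
    proof cases
      case 1
      then have "i \<in> A0" "j \<in> A0" using A(1) by (auto simp: P_def)
      from no_biclique[OF this[THEN B1(2)] this[THEN B1(3)]] 1 show False by blast
    next
      case 2
      have "B a \<times> B b \<inter> r = {} \<and> (\<forall>x\<in>B b. (a, x) \<in> r \<longleftrightarrow> a = b)" if ab: "a \<in> A" "b \<in> A" for a b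
      proof
        have sub: "B a \<subseteq> B1 a" "B b \<subseteq> B1 b" using 2 ab by auto
        have A0': "a \<in> A0" "b \<in> A0" using ab A(1) by auto
        show "B a \<times> B b \<inter> r = {}"
        proof (cases "a = b")
          case True
          then show ?thesis using sub B1(3)[OF A0'(1)] by blast
        next
          case False
          then have "(a, b) \<in> P" using ab by (auto simp: P_def)
          then show ?thesis using 2(2) by blast
        qed
        show "\<forall>x\<in>B b. (a, x) \<in> r \<longleftrightarrow> a = b"
        proof
          fix x assume x: "x \<in> B b"
          have "(b, x) \<in> r" using x sub B1(1)[OF A0'(2)] by auto
          \<comment> \<open>All of \<open>B1 b\<close> has trace \<open>T b\<close> on
            \<open>A0\<close>, so any centre adjacent to a leaf of \<open>b\<close> lies in
            \<open>T b\<close>. The choice of \<open>A\<close> then leaves only \<open>b\<close>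
            itself.\<close>
          moreover have "a \<in> T b" if "(a, x) \<in> r"
            using x sub that symD[OF r(1) that] A0' by (auto simp: B1_def)
          ultimately show "(a, x) \<in> r \<longleftrightarrow> a = b"
            using A(3) ab by metis
        qed
      qed
      moreover have "A \<times> A \<inter> r = {}" using A(1) A0(3) by blast
      moreover have "\<forall>a\<in>A. B a \<subseteq> V \<and> k \<le> card (B a)" using 2(1) A(1) B1(2) by blast
      ultimately have "stars_in k V r"
        unfolding stars_in_def using A(1,2) A0V by (intro exI[of _ A] exI[of _ B] conjI) auto
      then show False using neg by simp
    qed
  qed
qed

subsection \<open>Induced embeddings and the h-index\<close>

text \<open>This expresses that \<open>H\<close> is isomorphic to an induced subgraph of
  \<open>G\<close>. Well-formedness keeps the arcs of \<open>H\<close> inside its vertex set, so the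
  condition on pairs of vertices determines them all.\<close>

definition embeds :: "ngraph \<Rightarrow> ngraph \<Rightarrow> bool" where
  "embeds H G \<longleftrightarrow> pair_wf_digraph H \<and> (\<exists>f. inj_on f (pverts H) \<and> f ` pverts H \<subseteq> pverts G \<and>
     (\<forall>u\<in>pverts H. \<forall>v\<in>pverts H. (u, v) \<in> parcs H \<longleftrightarrow> (f u, f v) \<in> parcs G))"

lemma digraph_iso_imp_embeds:
  assumes "pair_wf_digraph G" and iso: "digraph_iso (with_proj G) (with_proj H)"
  shows "embeds H G"
proof -
  interpret pair_wf_digraph G by fact
  obtain f where f: "digraph_isomorphism f" and H: "with_proj H = app_iso f (with_proj G)"
    using iso unfolding digraph_iso_def by blast
  have inj: "inj_on (iso_verts f) (pverts G)"
    using f by (simp add: digraph_isomorphism_def)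
  have V: "pverts H = iso_verts f ` pverts G"
    using arg_cong[OF H, of verts] by simp
  \<comment> \<open>Tail and head are the projections in both graphs, so the arc map is determined
    by the vertex map.\<close>
  have A: "parcs H = iso_arcs f ` parcs G" and "iso_tail f = fst" "iso_head f = snd"
    using arg_cong[OF H, of arcs] arg_cong[OF H, of tail] arg_cong[OF H, of head] by simp_all
  then have arcs: "iso_arcs f a = (iso_verts f (fst a), iso_verts f (snd a))" if "a \<in> parcs G" for a
    using f that by (simp add: digraph_isomorphism_def prod_eq_iff)
  have "parcs H = (\<lambda>(u, v). (iso_verts f u, iso_verts f v)) ` parcs G"
    unfolding A by (rule image_cong) (auto simp: arcs)
  then have arc_iff: "(iso_verts f u, iso_verts f v) \<in> parcs H \<longleftrightarrow> (u, v) \<in> parcs G"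
    if "u \<in> pverts G" "v \<in> pverts G" for u v
    using that inj by (auto simp: inj_on_eq_iff in_arcsD1 in_arcsD2 intro: rev_image_eqI)
  have "wf_digraph (with_proj H)"
    unfolding H using f by (rule wf_digraphI_app_iso)
  then have "pair_wf_digraph H" by (simp add: wf_digraph_wp_iff)
  moreover have "inj_on (the_inv_into (pverts G) (iso_verts f)) (pverts H)"
    unfolding V using inj by (rule inj_on_the_inv_into)
  ultimately show ?thesis
    unfolding embeds_def using inj
    by (intro conjI exI[of _ "the_inv_into (pverts G) (iso_verts f)"])
      (auto simp: V the_inv_into_f_f arc_iff)
qed

lemma induced_subgraph_imp_embeds:
  assumes "induced_subgraph (with_proj H) (with_proj G)"
  shows "embeds H G"
  using assms unfolding embeds_def induced_subgraph_def subgraph_def wf_digraph_wp_iff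
  by (intro conjI exI[of _ id]) auto

text \<open>The image of the embedding induces a subgraph \<open>K\<close> of \<open>G\<close>,
  which lies in \<open>C\<close>, and the inverse \<open>g\<close> of the embedding is an
  isomorphism from \<open>K\<close> to \<open>H\<close>.\<close>

lemma hereditary_embeds:
  assumes C: "hereditary C" "G \<in> C" and "embeds H G"
  shows "H \<in> C"
proof -
  have "pair_graph G" using C unfolding hereditary_def graph_class_def by blast
  then interpret G: pair_graph G .
  obtain f where f: "inj_on f (pverts H)" "f ` pverts H \<subseteq> pverts G"
    "\<And>u v. u \<in> pverts H \<Longrightarrow> v \<in> pverts H \<Longrightarrow> (u, v) \<in> parcs H \<longleftrightarrow> (f u, f v) \<in> parcs G"
    and wf_H: "pair_wf_digraph H"
    using \<open>embeds H G\<close> unfolding embeds_def by blast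
  interpret H: pair_wf_digraph H by fact
  define K where "K = \<lparr>pverts = f ` pverts H, parcs = parcs G \<inter> (f ` pverts H \<times> f ` pverts H)\<rparr>"
  have K: "pverts K = f ` pverts H" "parcs K = parcs G \<inter> (f ` pverts H \<times> f ` pverts H)"
    by (simp_all add: K_def)
  have wf_K: "pair_wf_digraph K"
    by (rule pair_wf_digraph.intro) (auto simp: K)
  have "induced_subgraph (with_proj K) (with_proj G)"
    unfolding induced_subgraph_def subgraph_def compatible_def wf_digraph_wp_iff
  proof (intro conjI)
    show "verts (with_proj K) \<subseteq> verts (with_proj G)" using f(2) by (simp add: K)
    show "arcs (with_proj K) = {e \<in> arcs (with_proj G). tail (with_proj G) e \<in> verts (with_proj K) \<and>
        head (with_proj G) e \<in> verts (with_proj K)}"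
      by (rule set_eqI) (simp add: K mem_Times_iff)
  qed (use wf_K G.pair_wf_digraph_axioms in \<open>simp_all add: K\<close>)
  then have "K \<in> C"
    using C unfolding hereditary_def by blast
  define g where "g = the_inv_into (pverts H) f"
  have g: "g (f u) = u" if "u \<in> pverts H" for u
    using f(1) that by (simp add: g_def the_inv_into_f_f)
  define i where "i = \<lparr>iso_verts = g, iso_arcs = map_prod g g, iso_head = snd, iso_tail = fst\<rparr>"
  have inj: "inj_on g (pverts K)"
    by (auto simp: K g inj_on_def)
  moreover have "inj_on (map_prod g g) (parcs K)"
    by (rule inj_on_subset[OF map_prod_inj_on[OF inj inj]]) (auto simp: K)
  ultimately have "pre_digraph.digraph_isomorphism (with_proj K) i"
    using wf_K by (simp add: pre_digraph.digraph_isomorphism_def i_def wf_digraph_wp_iff)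
  moreover have "with_proj H = app_iso i (with_proj K)"
  proof -
    have "g ` pverts K = pverts H"
      by (force simp: K g)
    moreover have "map_prod g g ` parcs K = parcs H"
    proof (rule set_eqI, clarify)
      fix u v
      show "(u, v) \<in> map_prod g g ` parcs K \<longleftrightarrow> (u, v) \<in> parcs H"
      proof
        assume "(u, v) \<in> map_prod g g ` parcs K"
        then show "(u, v) \<in> parcs H" by (auto simp: K g f(3))
      next
        assume uv: "(u, v) \<in> parcs H"
        then have "u \<in> pverts H" "v \<in> pverts H" by (auto dest: H.wellformed')
        then show "(u, v) \<in> map_prod g g ` parcs K"
          using uv by (intro image_eqI[of _ _ "(f u, f v)"]) (auto simp: K g f(3))
      qed
    qed
    ultimately show ?thesis
      by (simp add: app_iso_def i_def with_proj_def)
  qed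
  ultimately have "digraph_iso (with_proj K) (with_proj H)"
    unfolding digraph_iso_def by blast
  then show ?thesis
    using C \<open>K \<in> C\<close> unfolding hereditary_def graph_class_def by blast
qed

text \<open>Isomorphisms and induced subgraphs are both embeddings, and every embedding factors
  through them. Heredity can therefore be checked with a single injective vertex map.\<close>

lemma hereditary_iff_embeds:
  "hereditary C \<longleftrightarrow> (\<forall>G\<in>C. pair_graph G) \<and> (\<forall>G\<in>C. \<forall>H. embeds H G \<longrightarrow> H \<in> C)"
proof
  assume "hereditary C"
  then show "(\<forall>G\<in>C. pair_graph G) \<and> (\<forall>G\<in>C. \<forall>H. embeds H G \<longrightarrow> H \<in> C)"
    using hereditary_embeds unfolding hereditary_def graph_class_def by blast
next
  assume C: "(\<forall>G\<in>C. pair_graph G) \<and> (\<forall>G\<in>C. \<forall>H. embeds H G \<longrightarrow> H \<in> C)"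
  then have "pair_wf_digraph G" if "G \<in> C" for G
    using that by (meson pair_graph.axioms(1) pair_digraph.axioms(1) pair_fin_digraph.axioms(1))
  then show "hereditary C"
    using C digraph_iso_imp_embeds induced_subgraph_imp_embeds
    unfolding hereditary_def graph_class_def by meson
qed

section \<open>The h-index in terms of neighbourhoods\<close>

lemma out_degree_with_proj: "out_degree (with_proj G) v = card (parcs G `` {v})"
proof -
  have "out_arcs (with_proj G) v = Pair v ` (parcs G `` {v})"
    by (auto simp: out_arcs_def)
  then show ?thesis
    by (simp add: out_degree_def card_image inj_on_def)
qed

text \<open>The predicate under \<open>GREATEST\<close> holds at 0 and only for numbers up to the
  number of vertices, so in a graph with finitely many vertices its greatest value exists and is
  attained.\<close>

lemma
  assumes "finite (pverts G)"
  shows h_index_attained: "h_index G \<le> card {v \<in> pverts G. h_index G \<le> card (parcs G `` {v})}"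
    and h_index_geI: "\<lbrakk>S \<subseteq> pverts G; k \<le> card S; \<And>v. v \<in> S \<Longrightarrow> k \<le> card (parcs G `` {v})\<rbrakk> \<Longrightarrow> k \<le> h_index G"
proof -
  define P where "P k \<longleftrightarrow> k \<le> card {v \<in> pverts G. k \<le> card (parcs G `` {v})}" for k
  have h: "h_index G = (GREATEST k. P k)"
    by (simp add: h_index_def P_def out_degree_with_proj)
  have bound: "k \<le> card (pverts G)" if "P k" for k
    using that card_mono[OF assms, of "{v \<in> pverts G. k \<le> card (parcs G `` {v})}"]
    by (simp add: P_def)
  have "P (h_index G)"
    unfolding h by (rule GreatestI_nat[of P 0 "card (pverts G)"]) (auto simp: P_def[of 0] bound)
  then show "h_index G \<le> card {v \<in> pverts G. h_index G \<le> card (parcs G `` {v})}"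
    by (simp add: P_def)
  assume S: "S \<subseteq> pverts G" "k \<le> card S" "\<And>v. v \<in> S \<Longrightarrow> k \<le> card (parcs G `` {v})"
  have "card S \<le> card {v \<in> pverts G. k \<le> card (parcs G `` {v})}"
    using S assms by (intro card_mono) auto
  then have "P k" using S(2) by (simp add: P_def)
  then show "k \<le> h_index G"
    unfolding h using bound by (rule Greatest_le_nat)
qed

subsection \<open>The three classes\<close>

lemma complete_graphs_iff:
  "G \<in> complete_graphs \<longleftrightarrow> finite (pverts G) \<and>
     parcs G = {(u, v). u \<in> pverts G \<and> v \<in> pverts G \<and> u \<noteq> v}"
  by (auto simp: complete_graphs_def complete_digraph_pair_def)

lemma complete_bipartite_graphs_iff:
  "G \<in> complete_bipartite_graphs \<longleftrightarrow> finite (pverts G) \<and>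
     (\<exists>U W. pverts G = U \<union> W \<and> U \<inter> W = {} \<and> parcs G = U \<times> W \<union> W \<times> U)"
  by (auto simp: complete_bipartite_graphs_def complete_bipartite_digraph_pair_def)

lemma star_iff:
  "star G \<longleftrightarrow> finite (pverts G) \<and> (\<exists>x W. pverts G = insert x W \<and> x \<notin> W \<and>
     parcs G = {x} \<times> W \<union> W \<times> {x})"
    (is "_ \<longleftrightarrow> ?R")
proof
  assume "star G"
  then obtain U W where G: "finite (pverts G)" "pverts G = U \<union> W" "U \<inter> W = {}" "card U = 1"
    "parcs G = U \<times> W \<union> W \<times> U"
    unfolding star_def complete_bipartite_digraph_pair_def by blast
  moreover obtain x where "U = {x}"
    using G(4) by (auto simp: card_1_singleton_iff)
  ultimately show ?R
    by (intro conjI exI[of _ x] exI[of _ W]) auto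
next
  assume ?R
  then obtain x W where G: "finite (pverts G)" "pverts G = {x} \<union> W" "{x} \<inter> W = {}"
    "parcs G = {x} \<times> W \<union> W \<times> {x}"
    by auto
  moreover have "card {x} = 1" by simp
  ultimately show "star G"
    unfolding star_def complete_bipartite_digraph_pair_def by blast
qed

text \<open>
  A star forest is described by the function sending each vertex to the centre of its star. In a
  star with a single edge either end may be taken as the centre.
\<close>

definition star_arcs :: "nat set \<Rightarrow> (nat \<Rightarrow> nat) \<Rightarrow> nat rel" where
  "star_arcs V c = {(u, v). u \<in> V \<and> v \<in> V \<and> u \<noteq> v \<and> c u = c v \<and> (u = c u \<or> v = c v)}"

lemma star_arcsD:
  assumes "(u, v) \<in> star_arcs V c"
  shows "c u = c v" "u = c u \<or> v = c v"
  using assms unfolding star_arcs_def by blast+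

text \<open>Disjointness assigns to each vertex the unique star \<open>own v\<close> containing it,
  and composing with a choice of centres gives \<open>c\<close>. Conversely, the fibres of an
  idempotent \<open>c\<close> are the vertex sets of the stars.\<close>

lemma star_forests_iff:
  "G \<in> star_forests \<longleftrightarrow> finite (pverts G) \<and>
     (\<exists>c. (\<forall>v\<in>pverts G. c v \<in> pverts G \<and> c (c v) = c v) \<and> parcs G = star_arcs (pverts G) c)"
    (is "?L \<longleftrightarrow> ?R")
proof
  assume ?L
  then obtain S where S: "finite S" "\<forall>H\<in>S. star H" "disjoint_family_on pverts S"
    and G: "pverts G = (\<Union>H\<in>S. pverts H)" "parcs G = (\<Union>H\<in>S. parcs H)"
    unfolding star_forests_def mem_Collect_eq by (elim exE conjE)
  have "\<forall>H\<in>S. \<exists>x. x \<in> pverts H \<and> parcs H = {x} \<times> (pverts H - {x}) \<union> (pverts H - {x}) \<times> {x}"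
    using S(2) by (fastforce simp: star_iff)
  from bchoice[OF this] obtain x where x: "\<And>H. H \<in> S \<Longrightarrow> x H \<in> pverts H"
    "\<And>H. H \<in> S \<Longrightarrow> parcs H = {x H} \<times> (pverts H - {x H}) \<union> (pverts H - {x H}) \<times> {x H}"
    by blast
  have "\<exists>own. \<forall>H\<in>S. \<forall>v\<in>pverts H. own v = H"
    using S(3) by (intro exI[of _ "\<lambda>v. THE H. H \<in> S \<and> v \<in> pverts H"])
      (auto simp: disjoint_family_on_def intro!: the_equality)
  then obtain own where own: "\<And>H v. H \<in> S \<Longrightarrow> v \<in> pverts H \<Longrightarrow> own v = H"
    by blast
  have own_in: "own v \<in> S" "v \<in> pverts (own v)" if "v \<in> pverts G" for v
    using that own G by auto
  define c where "c v = x (own v)" for v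
  have c: "c v \<in> pverts G" "own (c v) = own v" if "v \<in> pverts G" for v
  proof -
    have "c v \<in> pverts (own v)"
      using x(1) own_in(1)[OF that] by (simp add: c_def)
    then show "c v \<in> pverts G" "own (c v) = own v"
      using own_in(1)[OF that] own by (auto simp: G(1))
  qed
  have "parcs G = star_arcs (pverts G) c"
  proof (rule set_eqI, clarify)
    fix u v
    show "(u, v) \<in> parcs G \<longleftrightarrow> (u, v) \<in> star_arcs (pverts G) c"
    proof
      assume "(u, v) \<in> parcs G"
      then obtain H where H: "H \<in> S" "(u, v) \<in> parcs H" by (auto simp: G(2))
      then have uv: "u \<in> pverts H" "v \<in> pverts H" "u \<noteq> v" "u = x H \<or> v = x H"
        using x[OF H(1)] by auto
      then show "(u, v) \<in> star_arcs (pverts G) c"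
        using H(1) own[OF H(1)] by (auto simp: star_arcs_def c_def G(1))
    next
      assume "(u, v) \<in> star_arcs (pverts G) c"
      then have uv: "u \<in> pverts G" "v \<in> pverts G" "u \<noteq> v" "c u = c v" "u = c u \<or> v = c v"
        by (auto simp: star_arcs_def)
      \<comment> \<open>A centre lies in its own star, so equal centres force equal stars.\<close>
      then have "own u = own v" using c by metis
      then have "(u, v) \<in> parcs (own u)"
        using uv own_in[OF uv(1)] own_in[OF uv(2)] x(2) by (auto simp: c_def)
      then show "(u, v) \<in> parcs G" using own_in(1)[OF uv(1)] by (auto simp: G(2))
    qed
  qed
  moreover have "finite (pverts G)"
    using S G by (auto simp: star_iff)
  moreover have "\<forall>v\<in>pverts G. c v \<in> pverts G \<and> c (c v) = c v"
    using c by (metis c_def)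
  ultimately show ?R by blast
next
  assume ?R
  then obtain c where fin: "finite (pverts G)" and c: "\<And>v. v \<in> pverts G \<Longrightarrow> c v \<in> pverts G"
    "\<And>v. v \<in> pverts G \<Longrightarrow> c (c v) = c v" and arcs: "parcs G = star_arcs (pverts G) c"
    by blast
  define T where "T a = \<lparr>pverts = {v \<in> pverts G. c v = a},
    parcs = {(u, v) \<in> parcs G. c u = a \<and> c v = a}\<rparr>" for a
  have "star (T a)" if "a \<in> c ` pverts G" for a
  proof -
    have a: "a \<in> pverts G" "c a = a" using that c by auto
    define W where "W = {v \<in> pverts G. c v = a \<and> v \<noteq> a}"
    have "pverts (T a) = insert a W"
      using a unfolding T_def W_def by (intro set_eqI) (simp, blast)
    moreover have "parcs (T a) = {a} \<times> W \<union> W \<times> {a}"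
      using a unfolding T_def W_def arcs star_arcs_def by (intro set_eqI) (clarsimp, metis)
    moreover have "finite W" "a \<notin> W"
      using fin by (auto simp: W_def)
    ultimately show ?thesis
      unfolding star_iff by (intro conjI exI[of _ a] exI[of _ W]) simp_all
  qed
  moreover have "disjoint_family_on pverts (T ` c ` pverts G)"
    by (auto simp: disjoint_family_on_def T_def)
  moreover have "pverts G = (\<Union>H\<in>T ` c ` pverts G. pverts H)"
    by (auto simp: T_def)
  moreover have "parcs G = (\<Union>H\<in>T ` c ` pverts G. parcs H)"
    by (fastforce simp: T_def arcs star_arcs_def)
  ultimately show ?L
    unfolding star_forests_def using fin
    by (intro CollectI exI[of _ "T ` c ` pverts G"] conjI) simp_all
qed

section \<open>The three classes are hereditary\<close>

lemma complete_graphs_hereditary: "hereditary complete_graphs"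
proof (unfold hereditary_iff_embeds, intro conjI ballI allI impI)
  fix G assume "G \<in> complete_graphs"
  then show "pair_graph G"
    by (auto simp: complete_graphs_def complete_digraph_def intro: pair_graphI_graph)
next
  fix G H assume G: "G \<in> complete_graphs" and "embeds H G"
  then obtain f where f: "inj_on f (pverts H)" "f ` pverts H \<subseteq> pverts G"
    "\<And>u v. u \<in> pverts H \<Longrightarrow> v \<in> pverts H \<Longrightarrow> (u, v) \<in> parcs H \<longleftrightarrow> (f u, f v) \<in> parcs G"
    and "pair_wf_digraph H"
    unfolding embeds_def by blast
  interpret H: pair_wf_digraph H by fact
  have "finite (pverts H)"
    using f(1,2) G finite_subset[of "f ` pverts H" "pverts G"]
    by (auto simp: complete_graphs_iff finite_image_iff)
  moreover have "(u, v) \<in> parcs H \<longleftrightarrow> u \<noteq> v" if "u \<in> pverts H" "v \<in> pverts H" for u v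
  proof -
    have "f u \<in> pverts G" "f v \<in> pverts G" using that f(2) by auto
    then show ?thesis
      using that G inj_on_eq_iff[OF f(1)] by (auto simp: f(3) complete_graphs_iff)
  qed
  ultimately show "H \<in> complete_graphs"
    by (auto simp: complete_graphs_iff dest: H.wellformed')
qed

lemma complete_bipartite_graphs_hereditary: "hereditary complete_bipartite_graphs"
proof (unfold hereditary_iff_embeds, intro conjI ballI allI impI)
  fix G assume "G \<in> complete_bipartite_graphs"
  then show "pair_graph G"
    by (auto simp: complete_bipartite_graphs_def complete_bipartite_digraph_def intro: pair_graphI_graph)
next
  fix G H assume G: "G \<in> complete_bipartite_graphs" and "embeds H G"
  then obtain f where f: "inj_on f (pverts H)" "f ` pverts H \<subseteq> pverts G"
    "\<And>u v. u \<in> pverts H \<Longrightarrow> v \<in> pverts H \<Longrightarrow> (u, v) \<in> parcs H \<longleftrightarrow> (f u, f v) \<in> parcs G"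
    and "pair_wf_digraph H"
    unfolding embeds_def by blast
  interpret H: pair_wf_digraph H by fact
  obtain U W where UW: "pverts G = U \<union> W" "U \<inter> W = {}" "parcs G = U \<times> W \<union> W \<times> U"
    and fin: "finite (pverts G)"
    using G unfolding complete_bipartite_graphs_iff by blast
  have "finite (pverts H)"
    using f(1,2) fin finite_subset[of "f ` pverts H" "pverts G"]
    by (auto simp: finite_image_iff)
  \<comment> \<open>The parts of \<open>H\<close> are the preimages of the parts of
    \<open>G\<close>; either may be empty.\<close>
  moreover have "parcs H = {v \<in> pverts H. f v \<in> U} \<times> {v \<in> pverts H. f v \<in> W} \<union>
      {v \<in> pverts H. f v \<in> W} \<times> {v \<in> pverts H. f v \<in> U}"
    using f(3) by (auto simp: UW dest: H.wellformed')
  ultimately show "H \<in> complete_bipartite_graphs"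
    unfolding complete_bipartite_graphs_iff using UW f(2)
    by (intro conjI exI[of _ "{v \<in> pverts H. f v \<in> U}"] exI[of _ "{v \<in> pverts H. f v \<in> W}"]) auto
qed

lemma star_forests_hereditary: "hereditary star_forests"
proof (unfold hereditary_iff_embeds, intro conjI ballI allI impI)
  fix G assume "G \<in> star_forests"
  then obtain c where fin: "finite (pverts G)" and arcs: "parcs G = star_arcs (pverts G) c"
    unfolding star_forests_iff by blast
  have "parcs G \<subseteq> pverts G \<times> pverts G"
    by (auto simp: arcs star_arcs_def)
  then have "finite (parcs G)"
    using fin by (auto intro: finite_subset)
  then show "pair_graph G"
    using fin by unfold_locales (auto simp: arcs star_arcs_def symmetric_def sym_def)
next
  fix G H assume G: "G \<in> star_forests" and "embeds H G"
  then obtain f where f: "inj_on f (pverts H)" "f ` pverts H \<subseteq> pverts G"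
    "\<And>u v. u \<in> pverts H \<Longrightarrow> v \<in> pverts H \<Longrightarrow> (u, v) \<in> parcs H \<longleftrightarrow> (f u, f v) \<in> parcs G"
    and "pair_wf_digraph H"
    unfolding embeds_def by blast
  interpret H: pair_wf_digraph H by fact
  obtain c where c: "\<And>v. v \<in> pverts G \<Longrightarrow> c v \<in> pverts G" "\<And>v. v \<in> pverts G \<Longrightarrow> c (c v) = c v"
    and arcs: "parcs G = star_arcs (pverts G) c" and fin: "finite (pverts G)"
    using G unfolding star_forests_iff by blast
  have "finite (pverts H)"
    using f(1,2) fin finite_subset[of "f ` pverts H" "pverts G"]
    by (auto simp: finite_image_iff)
  define M where "M = f ` pverts H"
  \<comment> \<open>When the centre of a star is deleted, each of its leaves becomes its own centre.\<close>
  define d where "d v = (if c (f v) \<in> M then the_inv_into (pverts H) f (c (f v)) else v)" for v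
  have d: "d v \<in> pverts H \<and> f (d v) = (if c (f v) \<in> M then c (f v) else f v)"
    if "v \<in> pverts H" for v
    using that f(1) by (auto simp: d_def M_def the_inv_into_f_f f_the_inv_into_f)
  have eq: "u = v \<longleftrightarrow> f u = f v" if "u \<in> pverts H" "v \<in> pverts H" for u v
    using that f(1) by (simp add: inj_on_eq_iff)
  have fG: "f v \<in> pverts G" and fM: "f v \<in> M" if "v \<in> pverts H" for v
    using that f(2) by (auto simp: M_def)
  have "d (d v) = d v" if v: "v \<in> pverts H" for v
  proof -
    have "d v \<in> pverts H" "d (d v) \<in> pverts H" using d v by auto
    then have "d (d v) = d v \<longleftrightarrow> f (d (d v)) = f (d v)" by (rule eq[rotated])
    then show ?thesis
      using d[OF v] d[OF \<open>d v \<in> pverts H\<close>] c(2)[OF fG[OF v]] by auto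
  qed
  moreover have "parcs H = star_arcs (pverts H) d"
  proof (rule set_eqI, clarify)
    fix u v
    show "(u, v) \<in> parcs H \<longleftrightarrow> (u, v) \<in> star_arcs (pverts H) d"
    proof (cases "u \<in> pverts H \<and> v \<in> pverts H")
      case True
      then have uv: "u \<in> pverts H" "v \<in> pverts H" by auto
      have du: "d u \<in> pverts H" "d v \<in> pverts H" using d uv by auto
      have "(u, v) \<in> star_arcs (pverts H) d \<longleftrightarrow>
        f u \<noteq> f v \<and> f (d u) = f (d v) \<and> (f u = f (d u) \<or> f v = f (d v))"
        using uv du by (simp add: star_arcs_def eq)
      \<comment> \<open>Both sides fail as soon as the centre of \<open>f u\<close> or of
        \<open>f v\<close> lies outside \<open>M\<close>: on the right, the common centre would have
        to be \<open>f u\<close> or \<open>f v\<close>, which are in \<open>M\<close>. If both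
        centres lie in \<open>M\<close>, then \<open>f (d u)\<close> and \<open>f (d v)\<close> are
        these centres.\<close>
      also have "\<dots> \<longleftrightarrow> f u \<noteq> f v \<and> c (f u) = c (f v) \<and> (f u = c (f u) \<or> f v = c (f v))"
        using d[OF uv(1)] d[OF uv(2)] c(2)[OF fG[OF uv(1)]] c(2)[OF fG[OF uv(2)]] fM[OF uv(1)] fM[OF uv(2)]
        by (auto split: if_splits)
      also have "\<dots> \<longleftrightarrow> (f u, f v) \<in> parcs G"
        using fG uv by (simp add: arcs star_arcs_def)
      finally show ?thesis using f(3) uv by simp
    qed (auto simp: star_arcs_def dest: H.wellformed')
  qed
  ultimately show "H \<in> star_forests"
    unfolding star_forests_iff using \<open>finite (pverts H)\<close> d by blast
qed

section \<open>The three classes have unbounded h-index\<close>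

lemma unbounded_h_indexI:
  assumes "\<And>k. \<exists>G\<in>C. finite (pverts G) \<and>
    (\<exists>S\<subseteq>pverts G. k \<le> card S \<and> (\<forall>v\<in>S. k \<le> card (parcs G `` {v})))"
  shows "unbounded_h_index C"
  unfolding unbounded_h_index_def
proof
  assume "\<exists>b. \<forall>G\<in>C. h_index G \<le> b"
  then obtain b where b: "\<And>G. G \<in> C \<Longrightarrow> h_index G \<le> b" by blast
  obtain G S where "G \<in> C" "finite (pverts G)" "S \<subseteq> pverts G" "Suc b \<le> card S"
    "\<forall>v\<in>S. Suc b \<le> card (parcs G `` {v})"
    using assms[of "Suc b"] by blast
  then have "Suc b \<le> h_index G" by (intro h_index_geI) auto
  then show False using b[OF \<open>G \<in> C\<close>] by simp
qed

lemma unbounded_h_indexE: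
  assumes "unbounded_h_index C" and "\<And>G. G \<in> C \<Longrightarrow> finite (pverts G)"
  obtains G S where "G \<in> C" "S \<subseteq> pverts G" "k \<le> card S" "\<And>v. v \<in> S \<Longrightarrow> k \<le> card (parcs G `` {v})"
proof -
  obtain G where G: "G \<in> C" "\<not> h_index G \<le> k"
    using assms(1) unfolding unbounded_h_index_def by blast
  define S where "S = {v \<in> pverts G. h_index G \<le> card (parcs G `` {v})}"
  have "h_index G \<le> card S"
    unfolding S_def using assms(2)[OF G(1)] by (rule h_index_attained)
  show thesis
    by (rule that[of G S]) (use G \<open>h_index G \<le> card S\<close> in \<open>auto simp: S_def\<close>)
qed

lemma complete_graphs_unbounded: "unbounded_h_index complete_graphs"
proof (rule unbounded_h_indexI)
  fix k :: nat
  \<comment> \<open>There are \<open>k + 1\<close> vertices, so that every degree equals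
    \<open>k\<close>.\<close>
  define G :: ngraph where "G = \<lparr>pverts = {..k}, parcs = {(u, v). u \<le> k \<and> v \<le> k \<and> u \<noteq> v}\<rparr>"
  have "parcs G `` {v} = {..k} - {v}" if "v \<le> k" for v
    using that by (auto simp: G_def)
  then have "\<forall>v\<in>{..k}. k \<le> card (parcs G `` {v})"
    by simp
  moreover have "G \<in> complete_graphs" "finite (pverts G)" "{..k} \<subseteq> pverts G" "k \<le> card {..k}"
    by (auto simp: complete_graphs_iff G_def)
  ultimately show "\<exists>G\<in>complete_graphs. finite (pverts G) \<and>
      (\<exists>S\<subseteq>pverts G. k \<le> card S \<and> (\<forall>v\<in>S. k \<le> card (parcs G `` {v})))"
    by (intro bexI[of _ G] conjI exI[of _ "{..k}"])
qed

lemma complete_bipartite_graphs_unbounded: "unbounded_h_index complete_bipartite_graphs"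
proof (rule unbounded_h_indexI)
  fix k :: nat
  define U W where "U = {..<k}" and "W = {k..<2 * k}"
  define G :: ngraph where "G = \<lparr>pverts = U \<union> W, parcs = U \<times> W \<union> W \<times> U\<rparr>"
  have disj: "U \<inter> W = {}" by (auto simp: U_def W_def)
  then have "parcs G `` {v} = W" if "v \<in> U" for v
    using that by (auto simp: G_def)
  then have "\<forall>v\<in>U. k \<le> card (parcs G `` {v})"
    by (simp add: W_def)
  moreover have "G \<in> complete_bipartite_graphs"
    unfolding complete_bipartite_graphs_iff using disj
    by (intro conjI exI[of _ U] exI[of _ W]) (simp_all add: G_def U_def W_def)
  moreover have "finite (pverts G)" "U \<subseteq> pverts G" "k \<le> card U"
    by (auto simp: G_def U_def W_def)
  ultimately show "\<exists>G\<in>complete_bipartite_graphs. finite (pverts G) \<and>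
      (\<exists>S\<subseteq>pverts G. k \<le> card S \<and> (\<forall>v\<in>S. k \<le> card (parcs G `` {v})))"
    by (intro bexI[of _ G] conjI exI[of _ U])
qed

lemma star_forests_unbounded: "unbounded_h_index star_forests"
proof (rule unbounded_h_indexI)
  fix k :: nat
  \<comment> \<open>The vertices form \<open>k\<close> blocks of \<open>n\<close> consecutive
    numbers, and each block is a star centred at its least element, the multiple of \<open>n\<close>
    to which \<open>c\<close> rounds down. With \<open>n = Suc k\<close>, every centre has
    \<open>k\<close> leaves.\<close>
  define n where "n = Suc k"
  define V where "V = {..<k * n}"
  define c where "c v = v div n * n" for v
  define G :: ngraph where "G = \<lparr>pverts = V, parcs = star_arcs V c\<rparr>"
  have n: "0 < n" by (simp add: n_def)
  have c: "c (c v) = c v" "c v \<le> v" for v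
    using n by (simp_all add: c_def)
  have "G \<in> star_forests"
    unfolding star_forests_iff
  proof (intro conjI exI[of _ c] ballI)
    fix v assume "v \<in> pverts G"
    then show "c v \<in> pverts G"
      using c(2)[of v] by (simp add: G_def V_def)
  qed (simp_all add: G_def V_def c)
  moreover define S where "S = (\<lambda>j. j * n) ` {..<k}"
  have "k \<le> card (parcs G `` {v})" if "v \<in> S" for v
  proof -
    obtain j where j: "v = j * n" "j < k" using \<open>v \<in> S\<close> by (auto simp: S_def)
    have "Suc j * n \<le> k * n"
      using j(2) by (intro mult_right_mono) auto
    then have top: "j * n + i < k * n" if "i < n" for i
      using that by simp
    have cj: "c (j * n + i) = j * n" if "i < n" for i
      using that by (simp add: c_def)
    have "(v, j * n + i) \<in> parcs G" if "i \<in> {1..k}" for i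
    proof -
      have "i < n" "0 < i" using that by (auto simp: n_def)
      then show ?thesis
        using top[of i] top[of 0] cj[of i] cj[of 0] n
        by (simp add: G_def V_def star_arcs_def j)
    qed
    then have "(\<lambda>i. j * n + i) ` {1..k} \<subseteq> parcs G `` {v}"
      by blast
    moreover have "parcs G `` {v} \<subseteq> V" "finite V"
      by (auto simp: G_def star_arcs_def V_def)
    ultimately have "card ((\<lambda>i. j * n + i) ` {1..k}) \<le> card (parcs G `` {v})"
      by (meson card_mono finite_subset)
    then show ?thesis by (simp add: card_image)
  qed
  moreover have "card S = k"
    using n by (simp add: S_def card_image inj_on_def)
  moreover have "S \<subseteq> pverts G"
    using n by (auto simp: S_def G_def V_def)
  moreover have "finite (pverts G)"
    by (simp add: G_def V_def)
  ultimately show "\<exists>G\<in>star_forests. finite (pverts G) \<and>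
      (\<exists>S\<subseteq>pverts G. k \<le> card S \<and> (\<forall>v\<in>S. k \<le> card (parcs G `` {v})))"
    by (intro bexI[of _ G] conjI exI[of _ S] ballI) simp_all
qed

section \<open>Small graphs separating the three classes\<close>

lemma complete_graphs_arc:
  assumes "G \<in> complete_graphs" "u \<in> pverts G" "v \<in> pverts G" "u \<noteq> v"
  shows "(u, v) \<in> parcs G"
  using assms by (simp add: complete_graphs_iff)

lemma triangle_not_star_forest_or_bipartite:
  obtains G where "G \<in> complete_graphs" "G \<notin> star_forests" "G \<notin> complete_bipartite_graphs"
proof
  define G :: ngraph where "G = \<lparr>pverts = {0, 1, 2}, parcs = {(0,1),(1,0),(0,2),(2,0),(1,2),(2,1)}\<rparr>"
  show "G \<in> complete_graphs"
    by (auto simp: complete_graphs_iff G_def)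
  have arcs: "(0, 1) \<in> parcs G" "(0, 2) \<in> parcs G" "(1, 2) \<in> parcs G"
    by (auto simp: G_def)
  show "G \<notin> star_forests"
  proof
    assume "G \<in> star_forests"
    then obtain c where "parcs G = star_arcs (pverts G) c"
      unfolding star_forests_iff by blast
    then have eq: "c u = c v" "u = c u \<or> v = c v" if "(u, v) \<in> parcs G" for u v
      using that star_arcsD[of u v "pverts G" c] by simp_all
    have "c 1 = c 0" "c 2 = c 0"
      using arcs[THEN eq(1)] by metis+
    \<comment> \<open>All vertices have the same centre, which must lie on every edge; no vertex
      lies on all three edges of a triangle.\<close>
    then have "0 = c 0 \<or> 1 = c 0" "0 = c 0 \<or> 2 = c 0" "1 = c 0 \<or> 2 = c 0"
      using arcs[THEN eq(2)] by metis+
    then show False by presburger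
  qed
  show "G \<notin> complete_bipartite_graphs"
  proof
    assume "G \<in> complete_bipartite_graphs"
    then obtain U W where disj: "U \<inter> W = {}" and parcs: "parcs G = U \<times> W \<union> W \<times> U"
      unfolding complete_bipartite_graphs_iff by blast
    show False
      using arcs disj unfolding parcs by blast
  qed
qed

lemma four_cycle_not_star_forest_or_complete:
  obtains G where "G \<in> complete_bipartite_graphs" "G \<notin> star_forests" "G \<notin> complete_graphs"
proof
  define G :: ngraph where "G = \<lparr>pverts = {0, 1} \<union> {2, 3}, parcs = {0, 1} \<times> {2, 3} \<union> {2, 3} \<times> {0, 1}\<rparr>"
  show "G \<in> complete_bipartite_graphs"
    unfolding complete_bipartite_graphs_iff
    by (intro conjI exI[of _ "{0, 1}"] exI[of _ "{2, 3}"]) (simp_all add: G_def)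
  have arcs: "(0, 2) \<in> parcs G" "(0, 3) \<in> parcs G" "(1, 2) \<in> parcs G" "(1, 3) \<in> parcs G"
    by (auto simp: G_def)
  show "G \<notin> star_forests"
  proof
    assume "G \<in> star_forests"
    then obtain c where "parcs G = star_arcs (pverts G) c"
      unfolding star_forests_iff by blast
    then have eq: "c u = c v" "u = c u \<or> v = c v" if "(u, v) \<in> parcs G" for u v
      using that star_arcsD[of u v "pverts G" c] by simp_all
    have "c 2 = c 0" "c 3 = c 0" "c 1 = c 0"
      using arcs[THEN eq(1)] by metis+
    \<comment> \<open>Again a common centre would have to lie on all four edges of the
      cycle.\<close>
    then have "0 = c 0 \<or> 2 = c 0" "0 = c 0 \<or> 3 = c 0" "1 = c 0 \<or> 2 = c 0" "1 = c 0 \<or> 3 = c 0"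
      using arcs[THEN eq(2)] by metis+
    then show False by presburger
  qed
  have "(0, 1) \<notin> parcs G" "0 \<in> pverts G" "1 \<in> pverts G"
    by (auto simp: G_def)
  then show "G \<notin> complete_graphs"
    using complete_graphs_arc[of G 0 1] by auto
qed

lemma edge_plus_vertex_not_complete_or_bipartite:
  obtains G where "G \<in> star_forests" "G \<notin> complete_bipartite_graphs" "G \<notin> complete_graphs"
proof
  define G :: ngraph where "G = \<lparr>pverts = {0, 1, 2}, parcs = {(0, 1), (1, 0)}\<rparr>"
  define c :: "nat \<Rightarrow> nat" where "c v = (if v = 2 then 2 else 0)" for v
  show "G \<in> star_forests"
    unfolding star_forests_iff
    by (intro conjI exI[of _ c]) (auto simp: G_def c_def star_arcs_def)
  have V: "0 \<in> pverts G" "1 \<in> pverts G" "2 \<in> pverts G"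
    and arcs: "(0, 1) \<in> parcs G" "(0, 2) \<notin> parcs G" "(1, 2) \<notin> parcs G"
    by (auto simp: G_def)
  show "G \<notin> complete_bipartite_graphs"
  proof
    assume "G \<in> complete_bipartite_graphs"
    then obtain U W where verts: "pverts G = U \<union> W" and parcs: "parcs G = U \<times> W \<union> W \<times> U"
      unfolding complete_bipartite_graphs_iff by blast
    \<comment> \<open>Vertex 2 is adjacent to neither 0 nor 1, so both are in the same part as 2,
      where they cannot be adjacent to each other.\<close>
    show False
      using V arcs unfolding verts parcs by blast
  qed
  show "G \<notin> complete_graphs"
    using V arcs(2) complete_graphs_arc[of G 0 2] by auto
qed

subsection \<open>Minimality\<close>

lemma exists_inj_into:
  assumes "finite A" "finite B" "card A \<le> card B"
  obtains f where "inj_on f A" "f ` A \<subseteq> B"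
  using inj_on_iff_card_le[OF assms(1,2)] assms(3) by blast

lemma hereditary_pair_graph: "hereditary C \<Longrightarrow> G \<in> C \<Longrightarrow> pair_graph G"
  by (simp add: hereditary_iff_embeds)

lemma embedsI:
  assumes "pair_graph H" "inj_on f (pverts H)" "f ` pverts H \<subseteq> pverts G"
    "\<And>u v. u \<in> pverts H \<Longrightarrow> v \<in> pverts H \<Longrightarrow> (u, v) \<in> parcs H \<longleftrightarrow> (f u, f v) \<in> parcs G"
  shows "embeds H G"
proof -
  interpret H: pair_graph H by fact
  show ?thesis
    unfolding embeds_def using assms(2-4) H.pair_wf_digraph by blast
qed

lemma complete_graph_embeds:
  assumes G: "pair_graph G" "clique_in k (pverts G) (parcs G)"
    and H: "H \<in> complete_graphs" "card (pverts H) \<le> k"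
  shows "embeds H G"
proof -
  interpret G: pair_graph G by fact
  obtain K where K: "K \<subseteq> pverts G" "card K = k" "\<forall>a\<in>K. \<forall>b\<in>K. a \<noteq> b \<longrightarrow> (a, b) \<in> parcs G"
    using G(2) unfolding clique_in_def by blast
  have "finite K" using K(1) G.pair_finite_verts finite_subset by blast
  moreover have "finite (pverts H)" using H(1) by (simp add: complete_graphs_iff)
  ultimately obtain f where f: "inj_on f (pverts H)" "f ` pverts H \<subseteq> K"
    using exists_inj_into K(2) H(2) by blast
  show ?thesis
  proof (rule embedsI)
    show "pair_graph H" using H(1) complete_graphs_hereditary hereditary_pair_graph by blast
    fix u v assume uv: "u \<in> pverts H" "v \<in> pverts H"
    have "(u, v) \<in> parcs H \<longleftrightarrow> u \<noteq> v" using uv H(1) by (simp add: complete_graphs_iff)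
    moreover have "(f u, f v) \<in> parcs G \<longleftrightarrow> f u \<noteq> f v"
      using uv f(2) K(3) G.no_loops' by blast
    ultimately show "(u, v) \<in> parcs H \<longleftrightarrow> (f u, f v) \<in> parcs G"
      using uv f(1) by (simp add: inj_on_eq_iff)
  qed (use f K in auto)
qed

text \<open>Each part of \<open>H\<close> has at most \<open>k\<close> vertices and can be injected
  into its own side of the biclique.\<close>

lemma complete_bipartite_graph_embeds:
  assumes G: "pair_graph G" "biclique_in k (pverts G) (parcs G)"
    and H: "H \<in> complete_bipartite_graphs" "card (pverts H) \<le> k"
  shows "embeds H G"
proof -
  interpret G: pair_graph G by fact
  obtain X Y where XY: "X \<subseteq> pverts G" "Y \<subseteq> pverts G" "card X = k" "card Y = k"
    and arcs: "X \<times> X \<inter> parcs G = {}" "Y \<times> Y \<inter> parcs G = {}" "X \<times> Y \<subseteq> parcs G"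
    using G(2) unfolding biclique_in_def by blast
  obtain U W where UW: "pverts H = U \<union> W" "U \<inter> W = {}" "parcs H = U \<times> W \<union> W \<times> U"
    and fin: "finite (pverts H)"
    using H(1) unfolding complete_bipartite_graphs_iff by blast
  have "finite X" "finite Y" using XY G.pair_finite_verts finite_subset by blast+
  moreover have "card U \<le> card X" "card W \<le> card Y"
    using card_mono[OF fin, of U] card_mono[OF fin, of W] UW(1) XY(3,4) H(2) by auto
  moreover have "finite U" "finite W" using UW(1) fin by auto
  ultimately obtain g h where g: "inj_on g U" "g ` U \<subseteq> X" and h: "inj_on h W" "h ` W \<subseteq> Y"
    using exists_inj_into by meson
  have disj: "X \<inter> Y = {}" using arcs by blast
  define f where "f v = (if v \<in> U then g v else h v)" for v
  have f_U: "f v = g v" "f v \<in> X" if "v \<in> U" for v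
    using that g(2) by (auto simp: f_def)
  have f_W: "f v = h v" "f v \<in> Y" if "v \<in> W" for v
    using that h(2) UW(2) by (auto simp: f_def)
  show ?thesis
  proof (rule embedsI)
    show "pair_graph H" using H(1) complete_bipartite_graphs_hereditary hereditary_pair_graph by blast
    show "f ` pverts H \<subseteq> pverts G"
      using f_U(2) f_W(2) XY unfolding UW(1) by blast
    show "inj_on f (pverts H)"
    proof (rule inj_onI)
      fix u v assume "u \<in> pverts H" "v \<in> pverts H" "f u = f v"
      then show "u = v"
        using f_U f_W disj inj_onD[OF g(1)] inj_onD[OF h(1)] unfolding UW(1)
        by (metis Un_iff disjoint_iff)
    qed
    fix u v assume "u \<in> pverts H" "v \<in> pverts H"
    then consider "u \<in> U" "v \<in> U" | "u \<in> W" "v \<in> W" | "u \<in> U" "v \<in> W" | "u \<in> W" "v \<in> U"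
      unfolding UW(1) by blast
    then show "(u, v) \<in> parcs H \<longleftrightarrow> (f u, f v) \<in> parcs G"
    proof cases
      case 1
      then have "(f u, f v) \<notin> parcs G" using f_U(2) arcs(1) by blast
      then show ?thesis using 1 UW(2) unfolding UW(3) by blast
    next
      case 2
      then have "(f u, f v) \<notin> parcs G" using f_W(2) arcs(2) by blast
      then show ?thesis using 2 UW(2) unfolding UW(3) by blast
    next
      case 3
      then have "(f u, f v) \<in> parcs G" using f_U(2) f_W(2) arcs(3) by blast
      then show ?thesis using 3 unfolding UW(3) by blast
    next
      case 4
      then have "(f v, f u) \<in> parcs G" using f_U(2) f_W(2) arcs(3) by blast
      then have "(f u, f v) \<in> parcs G" by (rule G.arcs_symmetric)
      then show ?thesis using 4 unfolding UW(3) by blast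
    qed
  qed
qed

text \<open>Since \<open>H\<close> has at most \<open>k\<close> vertices, there are enough centres
  in \<open>A\<close> for all its stars and enough vertices in each leaf set for all leaves of one
  star. An injection \<open>g\<close> distributes the stars, and for each \<open>a\<close> an
  injection \<open>h a\<close> places the leaves.\<close>

lemma star_forest_embeds:
  assumes G: "pair_graph G" "stars_in k (pverts G) (parcs G)"
    and H: "H \<in> star_forests" "card (pverts H) \<le> k"
  shows "embeds H G"
proof -
  interpret G: pair_graph G by fact
  obtain A B where A: "A \<subseteq> pverts G" "card A = k" "A \<times> A \<inter> parcs G = {}"
    and B: "\<forall>a\<in>A. B a \<subseteq> pverts G \<and> k \<le> card (B a)"
    and AB: "\<forall>a\<in>A. \<forall>b\<in>A. B a \<times> B b \<inter> parcs G = {} \<and> (\<forall>x\<in>B b. (a, x) \<in> parcs G \<longleftrightarrow> a = b)"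
    using G(2) unfolding stars_in_def by (elim exE conjE)
  have AB_iff: "(a, x) \<in> parcs G \<longleftrightarrow> a = b" if "a \<in> A" "b \<in> A" "x \<in> B b" for a b x
    using AB that by blast
  have BB: "(x, y) \<notin> parcs G" if "a \<in> A" "b \<in> A" "x \<in> B a" "y \<in> B b" for a b x y
    using AB that by blast
  obtain c where fin: "finite (pverts H)"
    and c: "\<And>v. v \<in> pverts H \<Longrightarrow> c v \<in> pverts H" "\<And>v. v \<in> pverts H \<Longrightarrow> c (c v) = c v"
    and arcs: "parcs H = star_arcs (pverts H) c"
    using H(1) unfolding star_forests_iff by blast
  have "finite A" using A(1) G.pair_finite_verts finite_subset by blast
  then obtain g where g: "inj_on g (pverts H)" "g ` pverts H \<subseteq> A"
    using exists_inj_into[OF fin] A(2) H(2) by metis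
  have "\<forall>a\<in>A. \<exists>h. inj_on h (pverts H) \<and> h ` pverts H \<subseteq> B a"
  proof
    fix a assume a: "a \<in> A"
    then have "finite (B a)" "card (pverts H) \<le> card (B a)"
      using B H(2) G.pair_finite_verts finite_subset by (blast, force)
    then show "\<exists>h. inj_on h (pverts H) \<and> h ` pverts H \<subseteq> B a"
      using exists_inj_into[OF fin] by metis
  qed
  from bchoice[OF this] obtain h where
    h: "\<And>a. a \<in> A \<Longrightarrow> inj_on (h a) (pverts H)" "\<And>a. a \<in> A \<Longrightarrow> h a ` pverts H \<subseteq> B a"
    by blast
  \<comment> \<open>\<open>s v\<close> is the centre in \<open>G\<close> of the star that receives
    \<open>v\<close>; centres of \<open>H\<close> go to it, and leaves go into its leaf set.\<close>
  define s where "s v = g (c v)" for v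
  define f where "f v = (if c v = v then s v else h (s v) v)" for v
  have s: "s v \<in> A" if "v \<in> pverts H" for v
    using g(2) c(1)[OF that] by (auto simp: s_def)
  have s_eq: "s u = s v \<longleftrightarrow> c u = c v" if "u \<in> pverts H" "v \<in> pverts H" for u v
    using inj_on_eq_iff[OF g(1)] c(1) that by (simp add: s_def)
  have centre: "f v = s v" if "c v = v" for v
    using that by (simp add: f_def)
  have leaf: "f v = h (s v) v" "f v \<in> B (s v)" if "c v \<noteq> v" "v \<in> pverts H" for v
    using that h(2)[OF s[OF that(2)]] by (auto simp: f_def)
  have arc_s: "(s v, f v) \<in> parcs G" if "c v \<noteq> v" "v \<in> pverts H" for v
    using AB_iff[OF s s leaf(2)] that by blast
  show ?thesis
  proof (rule embedsI)
    show "pair_graph H" using H(1) star_forests_hereditary hereditary_pair_graph by blast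
    show "f ` pverts H \<subseteq> pverts G"
    proof
      fix x assume "x \<in> f ` pverts H"
      then obtain v where v: "v \<in> pverts H" "x = f v" by blast
      show "x \<in> pverts G"
        using centre leaf(2) s[OF v(1)] A(1) B v by (metis subsetD)
    qed
    \<comment> \<open>The image of a leaf is adjacent to an element of \<open>A\<close>, so it
      cannot be an element of the independent set \<open>A\<close>.\<close>
    have mixed: "f u \<noteq> f v" if "u \<in> pverts H" "v \<in> pverts H" "c u = u" "c v \<noteq> v" for u v
    proof
      assume "f u = f v"
      then have "(s v, s u) \<in> parcs G" using arc_s[OF that(4,2)] centre[OF that(3)] by simp
      then show False using A(3) s that(1,2) by blast
    qed
    show "inj_on f (pverts H)"
    proof (rule inj_onI)
      fix u v assume uv: "u \<in> pverts H" "v \<in> pverts H" and eq: "f u = f v"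
      consider "c u = u" "c v = v" | "c u \<noteq> u" "c v \<noteq> v"
        using mixed[OF uv] mixed[OF uv(2,1)] eq by metis
      then show "u = v"
      proof cases
        case 1
        then show ?thesis using eq centre s_eq[OF uv] by simp
      next
        case 2
        \<comment> \<open>The common image lies in \<open>B (s v)\<close> and is adjacent to
          \<open>s u\<close>, but a leaf has only one neighbour among the centres.\<close>
        have "s u = s v"
          using AB_iff[OF s s leaf(2), OF uv 2(2) uv(2)] arc_s[OF 2(1) uv(1)] eq by simp
        then show ?thesis
          using eq leaf(1) 2 uv inj_onD[OF h(1)[OF s[OF uv(1)]]] by simp
      qed
    qed
    have one: "(f u, f v) \<in> parcs G \<longleftrightarrow> c u = c v" if "u \<in> pverts H" "v \<in> pverts H" "c u = u" "c v \<noteq> v" for u v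
      using AB_iff[OF s s leaf(2), OF that(1,2,4,2)] centre[OF that(3)] s_eq[OF that(1,2)] by simp
    fix u v assume uv: "u \<in> pverts H" "v \<in> pverts H"
    have "(u, v) \<in> parcs H \<longleftrightarrow> u \<noteq> v \<and> c u = c v \<and> (c u = u \<or> c v = v)"
      using uv unfolding arcs star_arcs_def by auto
    moreover have "(f u, f v) \<in> parcs G \<longleftrightarrow> u \<noteq> v \<and> c u = c v \<and> (c u = u \<or> c v = v)"
    proof -
      consider "c u = u" "c v = v" | "c u \<noteq> u" "c v \<noteq> v" | "c u = u" "c v \<noteq> v" | "c u \<noteq> u" "c v = v"
        by blast
      then show ?thesis
      proof cases
        case 1
        then have "(f u, f v) \<notin> parcs G" using centre s[OF uv(1)] s[OF uv(2)] A(3) by auto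
        then show ?thesis using 1 by simp
      next
        case 2
        then show ?thesis using BB[OF s s leaf(2) leaf(2)] uv by blast
      next
        case 3
        then show ?thesis using one[OF uv 3] by auto
      next
        case 4
        have "(f u, f v) \<in> parcs G \<longleftrightarrow> (f v, f u) \<in> parcs G"
          using G.arcs_symmetric by blast
        then show ?thesis using 4 one[OF uv(2,1) 4(2,1)] by auto
      qed
    qed
    ultimately show "(u, v) \<in> parcs H \<longleftrightarrow> (f u, f v) \<in> parcs G" by simp
  qed
qed

text \<open>If all three classes had a member outside \<open>C\<close>, a graph in \<open>C\<close>
  of large h-index would contain a structure big enough to embed one of these members, which
  heredity forbids.\<close>

lemma hereditary_unbounded_contains:
  assumes C: "hereditary C" "unbounded_h_index C"
  shows "star_forests \<subseteq> C \<or> complete_bipartite_graphs \<subseteq> C \<or> complete_graphs \<subseteq> C"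
proof (rule ccontr)
  assume "\<not> ?thesis"
  then obtain H1 H2 H3 where H: "H1 \<in> star_forests" "H1 \<notin> C"
    "H2 \<in> complete_bipartite_graphs" "H2 \<notin> C" "H3 \<in> complete_graphs" "H3 \<notin> C"
    by blast
  \<comment> \<open>The sum bounds the order of all three missing graphs at once, so any of the
    three structures suffices.\<close>
  define k where "k = card (pverts H1) + card (pverts H2) + card (pverts H3)"
  obtain N where N: "\<forall>V (r :: nat rel) S. finite V \<longrightarrow> r \<subseteq> V \<times> V \<longrightarrow> sym r \<longrightarrow> irrefl r \<longrightarrow>
     S \<subseteq> V \<longrightarrow> N \<le> card S \<longrightarrow> (\<forall>v\<in>S. N \<le> card (r `` {v})) \<longrightarrow>
     clique_in k V r \<or> biclique_in k V r \<or> stars_in k V r"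
    using unavoidable_structures[of k] by (rule exE)
  have "finite (pverts G)" if "G \<in> C" for G
  proof -
    interpret pair_graph G using hereditary_pair_graph[OF C(1) that] .
    show ?thesis by (rule pair_finite_verts)
  qed
  then obtain G S where G: "G \<in> C" "S \<subseteq> pverts G" "N \<le> card S" "\<And>v. v \<in> S \<Longrightarrow> N \<le> card (parcs G `` {v})"
    using unbounded_h_indexE[OF C(2), where k = N] by metis
  have pg: "pair_graph G" using C(1) G(1) by (rule hereditary_pair_graph)
  then interpret G: pair_graph G .
  have "parcs G \<subseteq> pverts G \<times> pverts G"
    using G.wellformed' by auto
  moreover have "sym (parcs G)"
    using G.arcs_symmetric by (rule symI)
  moreover have "irrefl (parcs G)"
    using G.no_loops' unfolding irrefl_def by blast
  ultimately have "clique_in k (pverts G) (parcs G) \<or> biclique_in k (pverts G) (parcs G) \<or>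
      stars_in k (pverts G) (parcs G)"
    using N[THEN spec, THEN spec, THEN spec, of "pverts G" "parcs G" S] G.pair_finite_verts G(2-4)
    by simp
  then show False
  proof (elim disjE)
    assume "clique_in k (pverts G) (parcs G)"
    from complete_graph_embeds[OF pg this H(5)] show False
      using hereditary_embeds[OF C(1) G(1)] H(6) by (simp add: k_def)
  next
    assume "biclique_in k (pverts G) (parcs G)"
    from complete_bipartite_graph_embeds[OF pg this H(3)] show False
      using hereditary_embeds[OF C(1) G(1)] H(4) by (simp add: k_def)
  next
    assume "stars_in k (pverts G) (parcs G)"
    from star_forest_embeds[OF pg this H(1)] show False
      using hereditary_embeds[OF C(1) G(1)] H(2) by (simp add: k_def)
  qed
qed

theorem theorem10:
  shows "{C. minimal_hereditary_unbounded C} =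
           {star_forests, complete_bipartite_graphs, complete_graphs} \<and>
         distinct [star_forests, complete_bipartite_graphs, complete_graphs] \<and>
         (\<forall>C. hereditary C \<and> unbounded_h_index C \<longrightarrow>
            star_forests \<subseteq> C \<or> complete_bipartite_graphs \<subseteq> C \<or> complete_graphs \<subseteq> C)"
proof -
  let ?M = "{star_forests, complete_bipartite_graphs, complete_graphs}"
  have contains: "\<exists>X\<in>?M. X \<subseteq> C" if "hereditary C" "unbounded_h_index C" for C
    using hereditary_unbounded_contains[OF that] by blast
  have good: "hereditary X" "unbounded_h_index X" if "X \<in> ?M" for X
    using that star_forests_hereditary complete_bipartite_graphs_hereditary complete_graphs_hereditary
      star_forests_unbounded complete_bipartite_graphs_unbounded complete_graphs_unbounded by auto
  have incomparable:
    "\<not> complete_graphs \<subseteq> star_forests" "\<not> complete_graphs \<subseteq> complete_bipartite_graphs"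
    "\<not> complete_bipartite_graphs \<subseteq> star_forests" "\<not> complete_bipartite_graphs \<subseteq> complete_graphs"
    "\<not> star_forests \<subseteq> complete_bipartite_graphs" "\<not> star_forests \<subseteq> complete_graphs"
    using triangle_not_star_forest_or_bipartite four_cycle_not_star_forest_or_complete
      edge_plus_vertex_not_complete_or_bipartite by (metis subsetD)+
  then have antichain: "X = Y" if "X \<in> ?M" "Y \<in> ?M" "X \<subseteq> Y" for X Y
    using that by auto
  have distinct: "distinct [star_forests, complete_bipartite_graphs, complete_graphs]"
    using incomparable by auto
  have "minimal_hereditary_unbounded C \<longleftrightarrow> C \<in> ?M" for C
  proof
    assume C: "minimal_hereditary_unbounded C"
    then have min: "\<And>D. hereditary D \<Longrightarrow> unbounded_h_index D \<Longrightarrow> \<not> D \<subset> C"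
      and "hereditary C" "unbounded_h_index C"
      unfolding minimal_hereditary_unbounded_def by blast+
    from contains[OF this(2,3)] obtain X where X: "X \<in> ?M" "X \<subseteq> C" by (elim bexE)
    \<comment> \<open>The class \<open>X\<close> is itself hereditary of unbounded h-index, so
      minimality of \<open>C\<close> excludes proper inclusion.\<close>
    then have "X = C"
      using min[OF good[OF X(1)]] by (simp add: psubset_eq)
    with X(1) show "C \<in> ?M" by (simp only:)
  next
    assume C: "C \<in> ?M"
    \<comment> \<open>A proper subclass \<open>D\<close> would contain one of the three classes,
      which would then lie properly inside \<open>C\<close>, contradicting pairwise
      incomparability.\<close>
    have False if D: "D \<subset> C" "hereditary D" "unbounded_h_index D" for D
    proof -
      from contains[OF D(2,3)] obtain X where X: "X \<in> ?M" "X \<subseteq> D" by (elim bexE)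
      have "X \<subseteq> C" using X(2) D(1) by (rule order.trans[OF _ psubset_imp_subset])
      then have "X = C" by (rule antichain[OF X(1) C])
      then show False using X(2) D(1) by (simp add: psubset_eq)
    qed
    then show "minimal_hereditary_unbounded C"
      unfolding minimal_hereditary_unbounded_def using good[OF C] by blast
  qed
  then have "{C. minimal_hereditary_unbounded C} = ?M"
    by (intro set_eqI) (simp only: mem_Collect_eq)
  moreover have "\<forall>C. hereditary C \<and> unbounded_h_index C \<longrightarrow>
      star_forests \<subseteq> C \<or> complete_bipartite_graphs \<subseteq> C \<or> complete_graphs \<subseteq> C"
    using hereditary_unbounded_contains by simp
  ultimately show ?thesis
    using distinct by (intro conjI)
qed

end
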